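(* Let $m\ge 2$ be an integer and suppose $n=3m+l$ where $l$ is an integer with $\max(0,m-3)<l<m$. Then \[H_k(\mathbb{Z}_n,c_{m})\cong H_k(\mathbb{Z}_{n+4},c_{m+1})\quad\text{for all } k\in\mathbb{N}.\]
   Context: A (Čech) closure space is a pair $(X,c)$ of a set $X$ and a function $c:2^X\to 2^X$ with $c(\varnothing)=\varnothing$, $A\subset c(A)$, and $c(A\cup B)=c(A)\cup c(B)$ for all $A,B\subset X$. Topological spaces are the closure spaces with $c(c(A))=c(A)$ for all $A$, where $c$ is the topological closure. A map $f:(X,c)\to(Y,d)$ is continuous if $f(c(A))\subset d(f(A))$ for all $A\subset X$. $\mathbb{Z}_n=\{0,1,\dots,n-1\}$ with metric $d(i,j)=\min\{|k| : k\equiv i-j \bmod n\}$. For $m\ge 0$, $c_m(i)=\{j\in\mathbb{Z}_n : d(i,j)\le m\}$ and $c_m(A)=\bigcup_{i\in A}c_m(i)$ for $A\subset\mathbb{Z}_n$. Singular homology: let $|\Delta^n|=\{(t_0,\dots,t_n)\in\mathbb{R}^{n+1} : \sum_i t_i=1,\ t_i\ge 0\}=[e_0,\dots,e_n]$ with the Euclidean topology. For a closure space $X$, $C_n(X)$ is the free abelian group on continuous maps $\sigma:|\Delta^n|\to X$ (and $C_n(X)=0$ for $n<0$), $\partial_n(\sigma)=\sum_{i=0}^n(-1)^i\sigma|_{[e_0,\dots,\hat e_i,\dots,e_n]}$, and $H_n(X)=\ker\partial_n/\operatorname{im}\partial_{n+1}$; $H_k(\mathbb{Z}_n,c_m)$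 denotes $H_k$ of the closure space $(\mathbb{Z}_n,c_m)$ (not relative homology). *)

theory Defs
  imports "HOL-Homology.Homology" "HOL-Number_Theory.Cong"
begin

section \<open>Cech closure spaces\<close>

text \<open>The closure operation is only constrained on subsets of the underlying set.\<close>

locale closure_space =
  fixes X :: "'a set" and c :: "'a set \<Rightarrow> 'a set"
  assumes closure_in_space: "A \<subseteq> X \<Longrightarrow> c A \<subseteq> X"
    and closure_empty: "c {} = {}"
    and closure_extensive: "A \<subseteq> X \<Longrightarrow> A \<subseteq> c A"
    and closure_additive: "\<lbrakk>A \<subseteq> X; B \<subseteq> X\<rbrakk> \<Longrightarrow> c (A \<union> B) = c A \<union> c B"

lemma closure_space_topology: "closure_space (topspace T) (\<lambda>A. T closure_of A)"
  by unfold_locales (auto simp: closure_of_subset_topspace closure_of_subset closure_of_Un)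

definition closure_continuous ::
    "'a set \<Rightarrow> ('a set \<Rightarrow> 'a set) \<Rightarrow> 'b set \<Rightarrow> ('b set \<Rightarrow> 'b set) \<Rightarrow> ('a \<Rightarrow> 'b) \<Rightarrow> bool" where
  "closure_continuous X c Y d f \<longleftrightarrow> f \<in> X \<rightarrow> Y \<and> (\<forall>A. A \<subseteq> X \<longrightarrow> f ` c A \<subseteq> d (f ` A))"


section \<open>Singular homology of closure spaces\<close>

text \<open>
  The standard simplex, its faces and the boundary operator are those of HOL-Homology.  There
  a point of the standard simplex is a sequence supported on the first \<open>p + 1\<close> indices, the
  topology induced from the product topology is the Euclidean one, a singular simplex is
  \<open>undefined\<close> off the standard simplex (so that distinct elements of the function type are
  distinct maps), and \<open>chain_boundary 0\<close> is zero.
\<close>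

definition simplex_topology :: "nat \<Rightarrow> (nat \<Rightarrow> real) topology" where
  "simplex_topology p = subtopology (powertop_real UNIV) (standard_simplex p)"

definition closure_singular_simplex ::
    "nat \<Rightarrow> 'a set \<Rightarrow> ('a set \<Rightarrow> 'a set) \<Rightarrow> ((nat \<Rightarrow> real) \<Rightarrow> 'a) \<Rightarrow> bool" where
  "closure_singular_simplex p X c \<sigma> \<longleftrightarrow>
     closure_continuous (standard_simplex p) (\<lambda>A. simplex_topology p closure_of A) X c \<sigma> \<and>
     \<sigma> \<in> extensional (standard_simplex p)"

definition closure_chain_group ::
    "nat \<Rightarrow> 'a set \<Rightarrow> ('a set \<Rightarrow> 'a set) \<Rightarrow> 'a chain monoid" where
  "closure_chain_group p X c = free_Abelian_group (Collect (closure_singular_simplex p X c))"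

text \<open>
  For \<open>p = 0\<close> the boundary operator is zero, so the kernel is the whole chain group and the
  codomain \<open>closure_chain_group (p - 1) X c\<close> (with \<open>0 - 1 = 0\<close>) is irrelevant.
\<close>

definition closure_cycles ::
    "nat \<Rightarrow> 'a set \<Rightarrow> ('a set \<Rightarrow> 'a set) \<Rightarrow> 'a chain set" where
  "closure_cycles p X c =
     kernel (closure_chain_group p X c) (closure_chain_group (p - 1) X c) (chain_boundary p)"

definition closure_boundaries ::
    "nat \<Rightarrow> 'a set \<Rightarrow> ('a set \<Rightarrow> 'a set) \<Rightarrow> 'a chain set" where
  "closure_boundaries p X c =
     chain_boundary (Suc p) ` carrier (closure_chain_group (Suc p) X c)"

definition closure_homology_group ::
    "nat \<Rightarrow> 'a set \<Rightarrow> ('a set \<Rightarrow> 'a set) \<Rightarrow> 'a chain set monoid" where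
  "closure_homology_group p X c =
     (closure_chain_group p X c)\<lparr>carrier := closure_cycles p X c\<rparr> Mod closure_boundaries p X c"

text \<open>The quotient above is the one of an abelian group by a subgroup.\<close>

lemma carrier_closure_chain_group:
  "x \<in> carrier (closure_chain_group p X c) \<longleftrightarrow>
     Poly_Mapping.keys x \<subseteq> Collect (closure_singular_simplex p X c)"
  by (simp add: closure_chain_group_def free_Abelian_group_def)

lemma closure_cycles_iff:
  "x \<in> closure_cycles p X c \<longleftrightarrow>
     x \<in> carrier (closure_chain_group p X c) \<and> chain_boundary p x = 0"
  by (simp add: closure_cycles_def kernel_def closure_chain_group_def)

lemma closure_singular_simplex_face:
  assumes "closure_singular_simplex (Suc p) X c \<sigma>" "k \<le> Suc p"
  shows "closure_singular_simplex p X c (singular_face (Suc p) k \<sigma>)"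
proof -
  let ?f = "simplical_face k :: (nat \<Rightarrow> real) \<Rightarrow> nat \<Rightarrow> real"
  have img: "?f \<in> standard_simplex p \<rightarrow> standard_simplex (Suc p)"
    using assms(2) simplical_face_in_standard_simplex[of "Suc p" k] by auto
  have top: "topspace (simplex_topology q) = standard_simplex q" for q
    by (simp add: simplex_topology_def)
  have comp: "continuous_map (powertop_real UNIV) euclideanreal (\<lambda>x. simplical_face k x i)" for i
    unfolding simplical_face_def by (auto intro: continuous_map_product_projection)
  have cont: "continuous_map (simplex_topology p) (simplex_topology (Suc p)) ?f"
    using img comp unfolding simplex_topology_def
    by (auto simp: continuous_map_in_subtopology continuous_map_componentwise
        continuous_map_from_subtopology)
  have "singular_face (Suc p) k \<sigma> ` (simplex_topology p closure_of A)
          \<subseteq> c (singular_face (Suc p) k \<sigma> ` A)" if A: "A \<subseteq> standard_simplex p" for A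
  proof -
    have cl: "simplex_topology p closure_of A \<subseteq> standard_simplex p"
      using closure_of_subset_topspace top by metis
    have "singular_face (Suc p) k \<sigma> ` (simplex_topology p closure_of A)
            = \<sigma> ` (?f ` (simplex_topology p closure_of A))"
      using cl by (force simp: singular_face_def)
    also have "\<dots> \<subseteq> \<sigma> ` (simplex_topology (Suc p) closure_of (?f ` A))"
      using cont unfolding continuous_map_eq_image_closure_subset by (intro image_mono) blast
    also have "\<dots> \<subseteq> c (\<sigma> ` (?f ` A))"
    proof -
      have "?f ` A \<subseteq> standard_simplex (Suc p)"
        using A img by auto
      then show ?thesis
        using assms(1) by (simp add: closure_singular_simplex_def closure_continuous_def)
    qed
    also have "\<sigma> ` (?f ` A) = singular_face (Suc p) k \<sigma> ` A"
      using A by (force simp: singular_face_def)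
    finally show ?thesis .
  qed
  moreover have "singular_face (Suc p) k \<sigma> \<in> standard_simplex p \<rightarrow> X"
    using assms(1) img
    by (auto simp: singular_face_def closure_singular_simplex_def closure_continuous_def)
  ultimately show ?thesis
    by (simp add: closure_singular_simplex_def closure_continuous_def singular_face_def)
qed

lemma chain_boundary_closure_chain_group:
  assumes "x \<in> carrier (closure_chain_group (Suc p) X c)"
  shows "chain_boundary (Suc p) x \<in> carrier (closure_chain_group p X c)"
proof -
  let ?S = "Collect (closure_singular_simplex p X c)"
  let ?d = "\<lambda>\<sigma>. \<Sum>k\<le>Suc p. frag_cmul ((-1) ^ k) (frag_of (singular_face (Suc p) k \<sigma>))"
  have cmul: "Poly_Mapping.keys (frag_cmul a y) \<subseteq> ?S" if "Poly_Mapping.keys y \<subseteq> ?S"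
    for a and y :: "'a chain"
    using that keys_cmul by blast
  have "Poly_Mapping.keys (?d \<sigma>) \<subseteq> ?S" if "\<sigma> \<in> Poly_Mapping.keys x" for \<sigma>
  proof -
    have "Poly_Mapping.keys (frag_cmul ((-1) ^ k) (frag_of (singular_face (Suc p) k \<sigma>))) \<subseteq> ?S"
      if "k \<in> {..Suc p}" for k
      using that \<open>\<sigma> \<in> _\<close> assms closure_singular_simplex_face[of p X c \<sigma> k]
      by (intro cmul) (auto simp: carrier_closure_chain_group)
    then show ?thesis
      by (intro order.trans[OF keys_sum] UN_least)
  qed
  then have "Poly_Mapping.keys (frag_extend ?d x) \<subseteq> ?S"
    unfolding frag_extend_def by (intro order.trans[OF keys_sum] UN_least) (rule cmul)
  then show ?thesis
    by (simp add: chain_boundary_def carrier_closure_chain_group)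
qed

lemma chain_boundary_twice:
  fixes x :: "'a chain"
  assumes "x \<in> carrier (closure_chain_group (Suc p) X c)"
  shows "chain_boundary p (chain_boundary (Suc p) x) = 0"
proof -
  let ?T = "topology (\<lambda>U. U = {} \<or> U = UNIV) :: 'a topology"
  have "istopology (\<lambda>U. U = {} \<or> U = (UNIV :: 'a set))"
    unfolding istopology_def by blast
  then have op: "openin ?T U \<longleftrightarrow> U = {} \<or> U = UNIV" for U
    by (simp add: topology_inverse')
  then have top: "topspace ?T = UNIV"
    by (metis openin_subset top.extremum_uniqueI)
  have "continuous_map Y ?T f" for Y :: "(nat \<Rightarrow> real) topology" and f
    unfolding continuous_map_def by (auto simp: op top)
  then have "singular_chain (Suc p) ?T x"
    using assms unfolding singular_chain_def carrier_closure_chain_group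
    by (auto simp: singular_simplex_def closure_singular_simplex_def)
  then show ?thesis
    by (rule chain_boundary_boundary_alt)
qed

lemma comm_group_closure_cycles:
  "comm_group ((closure_chain_group p X c)\<lparr>carrier := closure_cycles p X c\<rparr>)"
proof -
  let ?G = "closure_chain_group p X c"
  have G: "comm_group ?G"
    by (simp add: closure_chain_group_def abelian_free_Abelian_group)
  have "group_hom ?G (free_Abelian_group UNIV) (chain_boundary p)"
    using G unfolding group_hom_def group_hom_axioms_def hom_def comm_group_def
    by (auto simp: closure_chain_group_def free_Abelian_group_def chain_boundary_add
        simp flip: free_Abelian_group_def)
  from group_hom.subgroup_kernel[OF this]
  have "subgroup (closure_cycles p X c) ?G"
    by (simp add: kernel_def closure_cycles_def closure_chain_group_def)
  then interpret Z: group "?G\<lparr>carrier := closure_cycles p X c\<rparr>"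
    using G by (intro subgroup.subgroup_is_group) (simp_all add: comm_group_def)
  show ?thesis
    by (rule Z.group_comm_groupI)
       (simp add: closure_chain_group_def free_Abelian_group_def add.commute)
qed

lemma closure_boundaries_subgroup:
  "subgroup (closure_boundaries p X c)
     ((closure_chain_group p X c)\<lparr>carrier := closure_cycles p X c\<rparr>)"
proof -
  let ?G = "closure_chain_group p X c"
  let ?Z = "?G\<lparr>carrier := closure_cycles p X c\<rparr>"
  have "group_hom (closure_chain_group (Suc p) X c) ?Z (chain_boundary (Suc p))"
    using comm_group_closure_cycles[of p X c]
      chain_boundary_closure_chain_group[of _ p X c] chain_boundary_twice[of _ p X c]
    unfolding group_hom_def group_hom_axioms_def hom_def comm_group_def
    by (auto simp: closure_cycles_iff chain_boundary_add)
       (auto simp: closure_chain_group_def chain_boundary_add)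
  from group_hom.img_is_subgroup[OF this]
  show ?thesis
    by (simp add: closure_boundaries_def)
qed

lemma group_closure_homology_group: "group (closure_homology_group p X c)"
  unfolding closure_homology_group_def
  by (intro normal.factorgroup_is_group)
     (simp add: comm_group.normal_iff_subgroup comm_group_closure_cycles
        closure_boundaries_subgroup)

text \<open>On topological spaces this is the singular homology of HOL-Homology.\<close>

lemma closure_singular_simplex_topology:
  "closure_singular_simplex p (topspace T) (\<lambda>A. T closure_of A) = singular_simplex p T"
proof
  fix \<sigma>
  let ?S = "subtopology (powertop_real UNIV) (standard_simplex p)"
  have top: "topspace ?S = standard_simplex p"
    by simp
  have "closure_continuous (standard_simplex p) (\<lambda>A. ?S closure_of A)
          (topspace T) (\<lambda>A. T closure_of A) \<sigma> \<longleftrightarrow> continuous_map ?S T \<sigma>" (is "?L \<longleftrightarrow> ?R")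
  proof
    assume L: ?L
    have "\<sigma> ` (?S closure_of A) \<subseteq> T closure_of (\<sigma> ` A)" for A
    proof -
      have "?S closure_of A = ?S closure_of (standard_simplex p \<inter> A)"
        using closure_of_restrict[of ?S A] top by simp
      also have "\<sigma> ` \<dots> \<subseteq> T closure_of (\<sigma> ` (standard_simplex p \<inter> A))"
        using L by (simp add: closure_continuous_def)
      also have "\<dots> \<subseteq> T closure_of (\<sigma> ` A)"
        by (intro closure_of_mono image_mono) auto
      finally show ?thesis .
    qed
    then show ?R
      unfolding continuous_map_eq_image_closure_subset by blast
  next
    assume R: ?R
    then have "\<sigma> \<in> standard_simplex p \<rightarrow> topspace T"
      using top by (metis continuous_map_funspace)
    then show ?L
      using R unfolding closure_continuous_def continuous_map_eq_image_closure_subset by blast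
  qed
  then show "closure_singular_simplex p (topspace T) (\<lambda>A. T closure_of A) \<sigma> = singular_simplex p T \<sigma>"
    by (simp add: closure_singular_simplex_def singular_simplex_def simplex_topology_def)
qed

lemma closure_chain_group_topology:
  "closure_chain_group p (topspace T) (\<lambda>A. T closure_of A) = chain_group p T"
  by (simp add: closure_chain_group_def chain_group_def closure_singular_simplex_topology)

lemma closure_homology_group_topology:
  "closure_homology_group p (topspace T) (\<lambda>A. T closure_of A) = homology_group (int p) T"
proof -
  have cycles: "closure_cycles p (topspace T) (\<lambda>A. T closure_of A) = singular_relcycle_set p T {}"
    by (auto simp: closure_cycles_def closure_chain_group_topology kernel_def singular_cycle)
  have boundaries:
    "closure_boundaries p (topspace T) (\<lambda>A. T closure_of A) = singular_relboundary_set p T {}"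
    by (auto simp: closure_boundaries_def closure_chain_group_topology singular_boundary)
  have "relcycle_group p T {} =
      (chain_group p T)\<lparr>carrier := carrier (relcycle_group p T {})\<rparr>"
    unfolding relcycle_group_def subgroup_generated_def by simp
  then have "(chain_group p T)\<lparr>carrier := singular_relcycle_set p T {}\<rparr> = relcycle_group p T {}"
    by (simp only: carrier_relcycle_group)
  then show ?thesis
    by (simp only: closure_homology_group_def nontrivial_relative_homology_group cycles boundaries
        closure_chain_group_topology)
qed


section \<open>The closure spaces on the integers modulo n\<close>

definition cyc :: "nat \<Rightarrow> int set" where
  "cyc n = {0..<int n}"

definition cyc_dist :: "nat \<Rightarrow> int \<Rightarrow> int \<Rightarrow> nat" where
  "cyc_dist n i j = (LEAST r. \<exists>k::int. [k = i - j] (mod int n) \<and> r = nat \<bar>k\<bar>)"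

definition cyc_closure :: "nat \<Rightarrow> nat \<Rightarrow> int set \<Rightarrow> int set" where
  "cyc_closure n m A = (\<Union>i\<in>A. {j \<in> cyc n. cyc_dist n i j \<le> m})"

lemma cyc_dist_self: "cyc_dist n i i = 0"
  unfolding cyc_dist_def by (rule Least_eq_0) (auto intro: exI[of _ 0])

lemma closure_space_cyc: "closure_space (cyc n) (cyc_closure n m)"
  by unfold_locales (auto simp: cyc_closure_def cyc_dist_self)

end

theory Submission
  imports Defs
begin

text \<open>
  Both spaces have the homology of a circle.  The hypotheses give \<open>n > 3 m\<close> and
  \<open>n + 4 > 3 (m + 1)\<close>, and for every \<open>m \<ge> 1\<close> and \<open>n > 3 m\<close> the homology of \<open>(\<int>\<^sub>n, c\<^sub>m)\<close> is infinite cyclic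
  in degrees \<open>0\<close> and \<open>1\<close> and trivial above (\<open>circle_homology\<close>).

  The reason is that reduction modulo \<open>n\<close> makes the line, that is, \<open>\<int>\<close> with
  neighbours at distance at most \<open>m\<close>, the universal covering of the cycle.  A map into the cycle is
  continuous iff near each point \<open>x\<close> its values stay in the ball of radius \<open>m\<close> around the value at \<open>x\<close>
  (\<open>closure_singular_simplex_iff\<close>).  If \<open>n > 3 m\<close>, such a ball on the cycle is an isomorphic copy
  of a ball on the line, adjacency included.  So continuous maps lift locally
  (\<open>liftable_star\<close>), hence on the whole simplex (\<open>liftable_standard_simplex\<close>), uniquely up to
  translation by multiples of \<open>n\<close> (\<open>lift_difference_constant\<close>).

  The line is contractible: clamping to shrinking intervals \<open>[-N, N]\<close>, with \<open>N\<close> coming down from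
  infinity, is a homotopy from the identity to a constant.  The corresponding cone operator
  on singular chains shows that the line is acyclic (\<open>line_acyclic\<close>, \<open>line_connected\<close>).

  Let \<open>T\<close> be the translation by \<open>n\<close>.  Then \<open>0 \<rightarrow> C(\<int>) \<rightarrow> C(\<int>) \<rightarrow> C(\<int>\<^sub>n) \<rightarrow> 0\<close>, with first map \<open>T - 1\<close>, is an
  exact sequence of chain complexes.  Its long exact homology sequence, which is here followed by
  hand on chains, kills the homology of the cycle above degree \<open>1\<close> and leaves
  the augmentation in degree \<open>0\<close> and the winding number in degree \<open>1\<close> as complete invariants.
\<close>

section \<open>Continuity into graphs\<close>

text \<open>
  The point \<open>x\<close> is the centre of the neighbourhood: values near \<open>x\<close> are related to \<open>f x\<close>, but two
  values at points near \<open>x\<close> need not be related to each other.  So a uniform scale at which all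
  values are pairwise related does not exist in general.
\<close>

definition rel_continuous_on :: "'a::topological_space set \<Rightarrow> ('b \<Rightarrow> 'b \<Rightarrow> bool) \<Rightarrow> ('a \<Rightarrow> 'b) \<Rightarrow> bool" where
  "rel_continuous_on K R f \<longleftrightarrow> (\<forall>x\<in>K. \<forall>\<^sub>F y in at x within K. R (f x) (f y))"

lemma rel_continuous_on_subset:
  "rel_continuous_on K R f \<Longrightarrow> L \<subseteq> K \<Longrightarrow> rel_continuous_on L R f"
  unfolding rel_continuous_on_def by (meson at_le filter_leD subsetD)

lemma rel_continuous_on_map:
  assumes "rel_continuous_on K R f" "\<And>i j. R i j \<Longrightarrow> S (h i) (h j)"
  shows "rel_continuous_on K S (\<lambda>x. h (f x))"
  unfolding rel_continuous_on_def
proof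
  fix x assume "x \<in> K"
  then have "\<forall>\<^sub>F y in at x within K. R (f x) (f y)"
    using assms(1) by (simp add: rel_continuous_on_def)
  then show "\<forall>\<^sub>F y in at x within K. S (h (f x)) (h (f y))"
    by (rule eventually_mono) (rule assms(2))
qed

lemma rel_continuous_on_cong:
  assumes "\<And>x. x \<in> K \<Longrightarrow> f x = g x"
  shows "rel_continuous_on K R f \<longleftrightarrow> rel_continuous_on K R g"
proof -
  have "(\<forall>\<^sub>F y in at x within K. R (f x) (f y)) \<longleftrightarrow> (\<forall>\<^sub>F y in at x within K. R (g x) (g y))"
    if "x \<in> K" for x
    using that assms by (intro eventually_cong) (auto simp: eventually_at_filter)
  then show ?thesis
    by (simp add: rel_continuous_on_def)
qed

lemma simplex_topology_eq: "simplex_topology p = top_of_set (standard_simplex p)"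
  by (simp add: simplex_topology_def euclidean_product_topology)

text \<open>
  When the closure of a set is the set of its neighbours, continuity can be tested locally.  In one
  direction, apply continuity to the set of all points whose value is not a neighbour of
  \<open>\<sigma> x\<close>: its closure cannot contain \<open>x\<close>.  This works for infinite graphs, too.
\<close>

lemma closure_singular_simplex_iff:
  assumes c: "\<And>A. A \<subseteq> X \<Longrightarrow> c A = {j \<in> X. \<exists>i\<in>A. R j i}"
    and refl: "\<And>i. R i i"
  shows "closure_singular_simplex p X c \<sigma> \<longleftrightarrow>
    \<sigma> \<in> extensional (standard_simplex p) \<and> \<sigma> \<in> standard_simplex p \<rightarrow> X \<and>
    rel_continuous_on (standard_simplex p) R \<sigma>"
proof -
  let ?D = "standard_simplex p"
  have cl: "simplex_topology p closure_of A = ?D \<inter> closure A" if "A \<subseteq> ?D" for A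
    using that by (simp add: simplex_topology_eq closure_of_subtopology Int_absorb1)
  have "(\<forall>A. A \<subseteq> ?D \<longrightarrow> \<sigma> ` (simplex_topology p closure_of A) \<subseteq> c (\<sigma> ` A))
      \<longleftrightarrow> rel_continuous_on ?D R \<sigma>" (is "?L \<longleftrightarrow> ?R") if \<sigma>: "\<sigma> \<in> ?D \<rightarrow> X"
  proof
    assume L: ?L
    show ?R
      unfolding rel_continuous_on_def
    proof
      fix x assume x: "x \<in> ?D"
      let ?A = "{y \<in> ?D. \<not> R (\<sigma> x) (\<sigma> y)}"
      have "\<sigma> ` ?A \<subseteq> X"
        using \<sigma> by auto
      then have "\<sigma> x \<notin> c (\<sigma> ` ?A)"
        unfolding c[OF \<open>\<sigma> ` ?A \<subseteq> X\<close>] by blast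
      moreover have "\<sigma> ` (?D \<inter> closure ?A) \<subseteq> c (\<sigma> ` ?A)"
        using L[rule_format, of ?A] cl[of ?A] by simp
      ultimately have "x \<notin> closure ?A"
        using x by blast
      then have "\<forall>\<^sub>F y in at x within ?D. y \<in> - closure ?A"
        unfolding eventually_at_topological by (intro exI[of _ "- closure ?A"]) (simp add: open_Compl)
      moreover have "?A \<subseteq> closure ?A"
        by (rule closure_subset)
      ultimately show "\<forall>\<^sub>F y in at x within ?D. R (\<sigma> x) (\<sigma> y)"
        unfolding eventually_at_filter by (auto elim: eventually_mono)
    qed
  next
    assume R: ?R
    show ?L
    proof (intro allI impI subsetI)
      fix A z assume A: "A \<subseteq> ?D" and "z \<in> \<sigma> ` (simplex_topology p closure_of A)"
      then obtain x where x: "x \<in> simplex_topology p closure_of A" and z: "z = \<sigma> x"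
        by blast
      then have xD: "x \<in> ?D" and xA: "x \<in> closure A"
        using cl[OF A] by auto
      obtain U where U: "open U" "x \<in> U" "\<And>y. y \<in> U \<Longrightarrow> y \<noteq> x \<Longrightarrow> y \<in> ?D \<Longrightarrow> R (\<sigma> x) (\<sigma> y)"
        using R xD unfolding rel_continuous_on_def eventually_at_topological by meson
      then obtain y where "y \<in> A" "y \<in> U"
        using xA closure_iff_nhds_not_empty[of x A] by blast
      then have "R (\<sigma> x) (\<sigma> y)"
        using U A refl by (cases "y = x") auto
      moreover have "\<sigma> ` A \<subseteq> X"
        using A \<sigma> by auto
      moreover have "z \<in> X"
        using xD \<sigma> z by auto
      ultimately show "z \<in> c (\<sigma> ` A)"
        using \<open>y \<in> A\<close> z c[of "\<sigma> ` A"] by auto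
    qed
  qed
  then show ?thesis
    unfolding closure_singular_simplex_def closure_continuous_def by blast
qed

definition line_near :: "nat \<Rightarrow> int \<Rightarrow> int \<Rightarrow> bool" where
  "line_near m i j \<longleftrightarrow> \<bar>i - j\<bar> \<le> int m"

definition circle_near :: "nat \<Rightarrow> nat \<Rightarrow> int \<Rightarrow> int \<Rightarrow> bool" where
  "circle_near n m i j \<longleftrightarrow> (\<exists>k. \<bar>k\<bar> \<le> int m \<and> int n dvd i - j - k)"

definition line_closure :: "nat \<Rightarrow> int set \<Rightarrow> int set" where
  "line_closure m A = {j. \<exists>i\<in>A. line_near m j i}"

lemma circle_near_sym: "circle_near n m i j \<Longrightarrow> circle_near n m j i"
proof -
  assume "circle_near n m i j"
  then obtain k where "\<bar>k\<bar> \<le> int m" "int n dvd - (i - j - k)"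
    unfolding circle_near_def dvd_minus_iff by blast
  then show ?thesis
    unfolding circle_near_def by (intro exI[of _ "-k"]) (simp add: algebra_simps)
qed

lemma circle_near_mod: "line_near m i j \<Longrightarrow> circle_near n m (i mod int n) (j mod int n)"
  unfolding line_near_def circle_near_def
proof (intro exI[of _ "i - j"] conjI)
  have "i mod int n - j mod int n - (i - j) = int n * (j div int n - i div int n)"
    by (simp add: algebra_simps minus_div_mult_eq_mod [symmetric])
  then show "int n dvd i mod int n - j mod int n - (i - j)"
    by simp
qed

lemma cyc_dist_le_iff: "cyc_dist n i j \<le> m \<longleftrightarrow> circle_near n m i j"
proof
  let ?P = "\<lambda>r. \<exists>k::int. [k = i - j] (mod int n) \<and> r = nat \<bar>k\<bar>"
  assume "cyc_dist n i j \<le> m"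
  moreover have "?P (cyc_dist n i j)"
    unfolding cyc_dist_def by (rule LeastI_ex) (auto intro: exI[of _ "i - j"])
  ultimately obtain k where "[i - j = k] (mod int n)" "\<bar>k\<bar> \<le> int m"
    by (auto simp: cong_sym_eq)
  then show "circle_near n m i j"
    by (auto simp: circle_near_def cong_iff_dvd_diff)
next
  assume "circle_near n m i j"
  then obtain k where k: "\<bar>k\<bar> \<le> int m" "[i - j = k] (mod int n)"
    by (auto simp: circle_near_def cong_iff_dvd_diff)
  then have "cyc_dist n i j \<le> nat \<bar>k\<bar>"
    unfolding cyc_dist_def by (intro Least_le) (auto simp: cong_sym_eq)
  then show "cyc_dist n i j \<le> m"
    using k by linarith
qed

lemma cyc_simplex_iff:
  "closure_singular_simplex p (cyc n) (cyc_closure n m) \<sigma> \<longleftrightarrow>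
    \<sigma> \<in> extensional (standard_simplex p) \<and> \<sigma> \<in> standard_simplex p \<rightarrow> cyc n \<and>
    rel_continuous_on (standard_simplex p) (circle_near n m) \<sigma>"
proof (rule closure_singular_simplex_iff)
  show "cyc_closure n m A = {j \<in> cyc n. \<exists>i\<in>A. circle_near n m j i}" for A
  proof -
    have "cyc_dist n i j \<le> m \<longleftrightarrow> circle_near n m j i" for i j
      using cyc_dist_le_iff circle_near_sym by metis
    then show ?thesis
      by (auto simp: cyc_closure_def)
  qed
  show "circle_near n m i i" for i
    unfolding circle_near_def by (rule exI[of _ 0]) simp
qed

lemma line_simplex_iff:
  "closure_singular_simplex p UNIV (line_closure m) \<sigma> \<longleftrightarrow>
    \<sigma> \<in> extensional (standard_simplex p) \<and> rel_continuous_on (standard_simplex p) (line_near m) \<sigma>"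
proof -
  have "line_closure m A = {j \<in> UNIV. \<exists>i\<in>A. line_near m j i}" for A
    by (simp add: line_closure_def)
  moreover have "line_near m i i" for i
    by (simp add: line_near_def)
  ultimately show ?thesis
    by (subst closure_singular_simplex_iff[where R = "line_near m"]) auto
qed

section \<open>Lifting from the cycle to the line\<close>

lemma dvd_small_imp_zero: "int n dvd d \<Longrightarrow> \<bar>d\<bar> < int n \<Longrightarrow> d = 0"
  using dvd_imp_le_int by force

text \<open>
  Two lifts differ by a multiple of \<open>n\<close>, and close to a given point this multiple changes by at most
  \<open>2 m < n\<close>, hence not at all.
\<close>

lemma lift_difference_constant:
  assumes "2 * m < n" "connected K"
    and g: "rel_continuous_on K (line_near m) g" and h: "rel_continuous_on K (line_near m) h"
    and dvd: "\<And>x. x \<in> K \<Longrightarrow> int n dvd g x - h x"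
    and "x \<in> K" "y \<in> K"
  shows "g x - h x = g y - h y"
proof (rule connected_local_const[OF \<open>connected K\<close> \<open>x \<in> K\<close> \<open>y \<in> K\<close>], rule ballI)
  fix a assume a: "a \<in> K"
  have "\<forall>\<^sub>F b in at a within K. b \<in> K \<and> line_near m (g a) (g b) \<and> line_near m (h a) (h b)"
    using g h a by (simp add: rel_continuous_on_def eventually_conj_iff eventually_at_filter)
  then show "\<forall>\<^sub>F b in at a within K. g a - h a = g b - h b"
  proof (rule eventually_mono)
    fix b assume b: "b \<in> K \<and> line_near m (g a) (g b) \<and> line_near m (h a) (h b)"
    then have "(g a - h a) - (g b - h b) = 0"
      using dvd a \<open>2 * m < n\<close>
      by (intro dvd_small_imp_zero[of n]) (auto simp: line_near_def intro: dvd_diff)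
    then show "g a - h a = g b - h b"
      by simp
  qed
qed

definition liftable :: "nat \<Rightarrow> nat \<Rightarrow> ('a::topological_space \<Rightarrow> int) \<Rightarrow> 'a set \<Rightarrow> bool" where
  "liftable n m f K \<longleftrightarrow>
    (\<exists>g. rel_continuous_on K (line_near m) g \<and> (\<forall>x\<in>K. int n dvd g x - f x))"

lemma liftable_subset: "liftable n m f K \<Longrightarrow> L \<subseteq> K \<Longrightarrow> liftable n m f L"
  unfolding liftable_def by (meson rel_continuous_on_subset subsetD)

lemma eventually_at_within_outside_closed:
  assumes "closed K" "x \<notin> K"
  shows "eventually P (at x within K)"
  unfolding eventually_at_topological using assms
  by (intro exI[of _ "- K"]) auto

text \<open>
  Two lifts can be glued after a translation that makes them agree at one common point, because
  then they agree on the whole connected intersection.  The pieces have to be closed so that a point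
  of only one piece has a neighbourhood missing the other.
\<close>

lemma liftable_Un:
  assumes "2 * m < n" and K: "closed K1" "closed K2" "connected (K1 \<inter> K2)"
    and "liftable n m f K1" "liftable n m f K2"
  shows "liftable n m f (K1 \<union> K2)"
proof -
  obtain g1 where g1: "rel_continuous_on K1 (line_near m) g1" "\<And>x. x \<in> K1 \<Longrightarrow> int n dvd g1 x - f x"
    using assms(5) unfolding liftable_def by blast
  obtain g2 where g2: "rel_continuous_on K2 (line_near m) g2" "\<And>x. x \<in> K2 \<Longrightarrow> int n dvd g2 x - f x"
    using assms(6) unfolding liftable_def by blast
  have dvd12: "int n dvd g1 x - g2 x" if "x \<in> K1 \<inter> K2" for x
    using dvd_diff[OF g1(2)[of x] g2(2)[of x]] that by simp
  obtain c where c: "int n dvd c" "\<And>x. x \<in> K1 \<inter> K2 \<Longrightarrow> g1 x = g2 x + c"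
  proof (cases "K1 \<inter> K2 = {}")
    case True
    then show ?thesis
      using that[of 0] by simp
  next
    case False
    then obtain z where z: "z \<in> K1 \<inter> K2"
      by blast
    have "g1 x - g2 x = g1 z - g2 z" if "x \<in> K1 \<inter> K2" for x
      using dvd12 z that
      by (intro lift_difference_constant[OF \<open>2 * m < n\<close> K(3)])
         (auto intro: rel_continuous_on_subset[OF g1(1)] rel_continuous_on_subset[OF g2(1)])
    then show ?thesis
      using that[of "g1 z - g2 z"] dvd12[OF z] by force
  qed
  define g where "g x = (if x \<in> K1 then g1 x else g2 x + c)" for x
  have g_K1: "g x = g1 x" if "x \<in> K1" for x
    using that by (simp add: g_def)
  have g_K2: "g x = g2 x + c" if "x \<in> K2" for x
    using that c(2) by (simp add: g_def)
  have "rel_continuous_on K1 (line_near m) g"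
    using g1(1) rel_continuous_on_cong[of K1 g g1, OF g_K1] by simp
  moreover have "rel_continuous_on K2 (line_near m) (\<lambda>x. g2 x + c)"
    by (rule rel_continuous_on_map[OF g2(1)]) (simp add: line_near_def)
  then have "rel_continuous_on K2 (line_near m) g"
    using rel_continuous_on_cong[of K2 g "\<lambda>x. g2 x + c", OF g_K2] by simp
  ultimately have "rel_continuous_on (K1 \<union> K2) (line_near m) g"
    unfolding rel_continuous_on_def at_within_union eventually_sup
    using eventually_at_within_outside_closed[OF K(1)] eventually_at_within_outside_closed[OF K(2)]
    by blast
  moreover have "int n dvd g x - f x" if "x \<in> K1 \<union> K2" for x
    using that g1(2)[of x] dvd_add[OF g2(2)[of x] c(1)]
    by (cases "x \<in> K1") (auto simp: g_def algebra_simps)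
  ultimately show ?thesis
    unfolding liftable_def by blast
qed

text \<open>
  The ball of radius \<open>m\<close> around \<open>v\<close> on the line maps bijectively to the ball around \<open>v\<close> on the
  cycle.  Adjacency is reflected as well: the difference of two elements of the ball is at
  most \<open>2 m\<close>, so it cannot be congruent to a different number of size at most \<open>m\<close> as long
  as \<open>3 m < n\<close>, that is, as long as three steps of length \<open>m\<close> cannot go around the cycle.
\<close>

lemma liftable_star:
  assumes "3 * m < n" and f: "rel_continuous_on K (circle_near n m) f"
    and star: "\<And>y. y \<in> K \<Longrightarrow> circle_near n m (f y) v"
  shows "liftable n m f K"
proof -
  obtain d where d: "\<And>y. y \<in> K \<Longrightarrow> \<bar>d y\<bar> \<le> int m \<and> int n dvd f y - v - d y"
    using star unfolding circle_near_def by metis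
  let ?g = "\<lambda>y. v + d y"
  have "rel_continuous_on K (line_near m) ?g"
    unfolding rel_continuous_on_def
  proof
    fix x assume x: "x \<in> K"
    have "\<forall>\<^sub>F y in at x within K. y \<in> K \<and> circle_near n m (f x) (f y)"
      using f x by (simp add: rel_continuous_on_def eventually_conj_iff eventually_at_filter)
    then show "\<forall>\<^sub>F y in at x within K. line_near m (?g x) (?g y)"
    proof (rule eventually_mono)
      fix y assume y: "y \<in> K \<and> circle_near n m (f x) (f y)"
      then obtain k where k: "\<bar>k\<bar> \<le> int m" "int n dvd f x - f y - k"
        by (auto simp: circle_near_def)
      have "int n dvd (f x - f y - k) - (f x - v - d x) + (f y - v - d y)"
        using dvd_add[OF dvd_diff[OF k(2)]] d x y by blast
      then have "int n dvd d x - d y - k"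
        by (simp add: algebra_simps)
      then have "d x - d y - k = 0"
        using d[OF x] d[of y] y k \<open>3 * m < n\<close>
        by (intro dvd_small_imp_zero[of n]) auto
      then show "line_near m (?g x) (?g y)"
        using k(1) by (simp add: line_near_def)
    qed
  qed
  moreover have "int n dvd ?g y - f y" if "y \<in> K" for y
    using d[OF that] dvd_minus_iff[of "int n" "f y - v - d y"] by (simp add: algebra_simps)
  ultimately show ?thesis
    unfolding liftable_def by blast
qed

lemma connected_of_segments:
  fixes K :: "(nat \<Rightarrow> real) set"
  assumes "\<And>x y u. \<lbrakk>x \<in> K; y \<in> K; 0 \<le> u; u \<le> 1\<rbrakk> \<Longrightarrow> (\<lambda>i. (1 - u) * x i + u * y i) \<in> K"
  shows "connected K"
proof (rule connectedI_const)
  fix P :: "(nat \<Rightarrow> real) \<Rightarrow> bool"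
  assume P: "continuous_on K P"
  have "P x = P y" if "x \<in> K" "y \<in> K" for x y
  proof -
    let ?g = "\<lambda>u i. (1 - u) * x i + u * y i"
    have "continuous_on {0..1::real} ?g"
      by (intro continuous_intros)
    moreover have "?g ` {0..1} \<subseteq> K"
      using assms that by auto
    ultimately have "continuous_on {0..1} (\<lambda>u. P (?g u))"
      using continuous_on_compose2[OF P] by blast
    then obtain c where c: "\<forall>u\<in>{0..1}. P (?g u) = c"
      using connectedD_const[of "{0..1::real}" "\<lambda>u. P (?g u)"] connected_Icc by blast
    have "P x = c" "P y = c"
      using bspec[OF c, of 0] bspec[OF c, of 1] by simp_all
    then show ?thesis
      by simp
  qed
  then have "\<forall>s\<in>K. P s = P (SOME x. x \<in> K)"
    by (metis someI)
  then show "\<exists>c. \<forall>s\<in>K. P s = c" ..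
qed

text \<open>
  On points supported in the first \<open>p + 1\<close> coordinates, the product topology is the topology of
  finite-dimensional boxes.
\<close>

lemma open_contains_box:
  fixes x :: "nat \<Rightarrow> real"
  assumes "open S" "x \<in> S" "\<And>i. i > p \<Longrightarrow> x i = 0"
  shows "\<exists>e>0. \<forall>y. (\<forall>i>p. y i = 0) \<and> (\<forall>i\<le>p. \<bar>y i - x i\<bar> \<le> e) \<longrightarrow> y \<in> S"
proof -
  have "openin (powertop_real UNIV) S"
    using assms(1) by (simp add: euclidean_product_topology)
  from product_topology_open_contains_basis[OF this assms(2)]
  obtain X where X: "x \<in> (\<Pi>\<^sub>E i\<in>UNIV. X i)" "\<And>i. open (X i)" "(\<Pi>\<^sub>E i\<in>UNIV. X i) \<subseteq> S"
    by auto
  have "\<exists>e>0. \<forall>r. \<bar>r - x i\<bar> \<le> e \<longrightarrow> r \<in> X i" for i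
  proof -
    have "x i \<in> X i"
      using X(1) by auto
    then obtain e where "e > 0" "cball (x i) e \<subseteq> X i"
      using X(2) open_contains_cball by metis
    then show ?thesis
      by (intro exI[of _ e]) (auto simp: subset_iff dist_real_def abs_minus_commute)
  qed
  then obtain e where e: "\<And>i. e i > 0" "\<And>i r. \<bar>r - x i\<bar> \<le> e i \<Longrightarrow> r \<in> X i"
    by metis
  let ?e = "Min (e ` {..p})"
  have "?e > 0"
    using e by (subst Min_gr_iff) auto
  moreover have "y \<in> S" if "\<forall>i>p. y i = 0" "\<forall>i\<le>p. \<bar>y i - x i\<bar> \<le> ?e" for y
  proof -
    have "y i \<in> X i" for i
    proof (cases "i \<le> p")
      case True
      then have "?e \<le> e i"
        by (intro Min_le) auto
      then show ?thesis
        using that(2) True e(2) by force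
    next
      case False
      then show ?thesis
        using that(1) assms(3) e(1)[of i] by (intro e(2)) auto
    qed
    then show ?thesis
      using X(3) by auto
  qed
  ultimately show ?thesis
    by blast
qed

lemma closed_standard_simplex: "closed (standard_simplex p)"
  using closedin_standard_simplex[of p] by (simp add: euclidean_product_topology)

text \<open>
  A tube argument, releasing one coordinate at a time: if every point has a liftable box around it
  in the coordinates \<open>j, \<dots>, p\<close> (with the coordinates before \<open>j\<close> unconstrained), then the same is
  true for \<open>j + 1\<close>.  The unit interval of values of the coordinate \<open>j\<close> is covered by such boxes,
  and bisection of that interval reduces the claim to gluing two slabs along a convex slab.
\<close>

theorem liftable_standard_simplex:
  assumes n: "3 * m < n" and f: "rel_continuous_on (standard_simplex p) (circle_near n m) f"
  shows "liftable n m f (standard_simplex p)"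
proof -
  let ?D = "standard_simplex p"
  \<comment> \<open>The centre \<open>x\<close> ranges over all points of the coordinate space, not only those of the simplex,
    so that one coordinate of it can be changed freely.\<close>
  define B where "B j x e = {y \<in> ?D. \<forall>i\<in>{j..p}. \<bar>y i - x i\<bar> \<le> e}" for j x and e :: real
  have "\<exists>e>0. liftable n m f (B j x e)" if "\<forall>i>p. x i = 0" for j x
    using that
  proof (induction j arbitrary: x)
    case 0
    obtain S where S: "open S" "x \<in> S" "\<And>y. y \<in> S \<Longrightarrow> y \<in> ?D \<Longrightarrow> circle_near n m (f y) (f x)"
    proof (cases "x \<in> ?D")
      case True
      then obtain S where S: "open S" "x \<in> S" "\<And>y. y \<in> S \<Longrightarrow> y \<noteq> x \<Longrightarrow> y \<in> ?D \<Longrightarrow> circle_near n m (f x) (f y)"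
        using f unfolding rel_continuous_on_def eventually_at_topological by meson
      have "circle_near n m (f x) (f x)"
        unfolding circle_near_def by (rule exI[of _ 0]) simp
      then show ?thesis
        using that S circle_near_sym by metis
    next
      case False
      then show ?thesis
        using that[of "- ?D"] closed_standard_simplex by auto
    qed
    obtain e where e: "e > 0" "\<And>y. (\<forall>i>p. y i = 0) \<Longrightarrow> (\<forall>i\<le>p. \<bar>y i - x i\<bar> \<le> e) \<Longrightarrow> y \<in> S"
      using open_contains_box[OF S(1,2), of p] 0 by blast
    have "liftable n m f (B 0 x e)"
    proof (rule liftable_star[OF n])
      show "rel_continuous_on (B 0 x e) (circle_near n m) f"
        by (rule rel_continuous_on_subset[OF f]) (auto simp: B_def)
      show "circle_near n m (f y) (f x)" if "y \<in> B 0 x e" for y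
        using that by (intro S(3) e(2)) (auto simp: B_def standard_simplex_def)
    qed
    then show ?case
      using e(1) by blast
  next
    case (Suc j)
    show ?case
    proof (cases "j \<le> p")
      case False
      then have "B (Suc j) x e = B j x e" for e
        by (auto simp: B_def)
      then show ?thesis
        using Suc by simp
    next
      case True
      define C where "C a b e = {y \<in> ?D. a \<le> y j \<and> y j \<le> b \<and> (\<forall>i\<in>{Suc j..p}. \<bar>y i - x i\<bar> \<le> e)}"
        for a b e :: real
      have closed_C: "closed (C a b e)" for a b e
      proof -
        have "C a b e = ?D \<inter> {y. a \<le> y j} \<inter> {y. y j \<le> b} \<inter> (\<Inter>i\<in>{Suc j..p}. {y. \<bar>y i - x i\<bar> \<le> e})"
          by (auto simp: C_def)
        then show ?thesis
          by (auto intro!: closed_Int closed_INT closed_Collect_le continuous_intros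
              closed_standard_simplex)
      qed
      have connected_C: "connected (C a b e \<inter> C a' b' e')" for a b e a' b' e'
      proof (rule connected_of_segments)
        fix y z u
        assume yz: "y \<in> C a b e \<inter> C a' b' e'" "z \<in> C a b e \<inter> C a' b' e'" and u: "0 \<le> (u::real)" "u \<le> 1"
        have lo: "r \<le> (1 - u) * s + u * t" if "r \<le> s" "r \<le> t" for r s t
          using convex_bound_le[of "-s" "-r" "-t" "1-u" u] that u by simp
        have hi: "(1 - u) * s + u * t \<le> r" if "s \<le> r" "t \<le> r" for r s t
          using convex_bound_le[of s r t "1-u" u] that u by simp
        have near: "\<bar>(1 - u) * s + u * t - r\<bar> \<le> e" if "\<bar>s - r\<bar> \<le> e" "\<bar>t - r\<bar> \<le> e" for r s t e
          using lo[of "r - e" s t] hi[of s "r + e" t] that by (simp add: abs_le_iff)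
        show "(\<lambda>i. (1 - u) * y i + u * z i) \<in> C a b e \<inter> C a' b' e'"
          using yz convex_standard_simplex[of y p z u] u by (auto simp: C_def lo hi near)
      qed
      \<comment> \<open>The size of the box in the later coordinates may shrink with each gluing step.\<close>
      define P where "P a b \<longleftrightarrow> (\<exists>e>0. liftable n m f (C a b e))" for a b
      have "P 0 1"
      proof (rule Bolzano[of 0 1 P])
        fix a b c assume ab: "P a b" and bc: "P b c" and "a \<le> b" "b \<le> c"
        obtain e1 e2 where e: "e1 > 0" "liftable n m f (C a b e1)" "e2 > 0" "liftable n m f (C b c e2)"
          using ab bc by (auto simp: P_def)
        let ?e = "min e1 e2"
        have "liftable n m f (C a b ?e)" "liftable n m f (C b c ?e)"
          using e by (auto intro: liftable_subset simp: C_def)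
        then have "liftable n m f (C a b ?e \<union> C b c ?e)"
          using n by (intro liftable_Un closed_C connected_C) auto
        moreover have "C a c ?e \<subseteq> C a b ?e \<union> C b c ?e"
          by (auto simp: C_def)
        ultimately show "P a c"
          using e liftable_subset unfolding P_def by (intro exI[of _ ?e]) auto
      next
        fix t :: real
        have "\<forall>i>p. (x(j := t)) i = 0"
          using Suc.prems True by auto
        then obtain e where e: "e > 0" "liftable n m f (B j (x(j := t)) e)"
          using Suc.IH by blast
        have "P a b" if "a \<le> t" "t \<le> b" "b - a < e" for a b
        proof -
          have "C a b e \<subseteq> B j (x(j := t)) e"
            using that by (auto simp: C_def B_def)
          then show ?thesis
            unfolding P_def using e liftable_subset by blast
        qed
        then show "\<exists>d>0. \<forall>a b. a \<le> t \<and> t \<le> b \<and> b - a < d \<longrightarrow> P a b"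
          using e(1) by blast
      qed simp
      then obtain e where "e > 0" "liftable n m f (C 0 1 e)"
        by (auto simp: P_def)
      moreover have "B (Suc j) x e = C 0 1 e"
        by (auto simp: B_def C_def standard_simplex_def)
      ultimately show ?thesis
        by auto
    qed
  qed
  from this[of "\<lambda>_. 0" "Suc p"] obtain e where "liftable n m f (B (Suc p) (\<lambda>_. 0) e)"
    by blast
  then show ?thesis
    by (simp add: B_def)
qed

section \<open>Contracting the integer line\<close>

text \<open>
  A homotopy from the identity of the line to the constant \<open>0\<close>: at time \<open>s > 0\<close> all integers are
  clamped to the interval of radius \<open>\<lfloor>1 / s\<rfloor> - 1\<close>.  The radius decreases by steps of one, which keeps
  the homotopy continuous for positive times, and it tends to infinity as \<open>s\<close> tends to \<open>0\<close>, so near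
  time \<open>0\<close> it exceeds any given integer and the clamping has no effect there.  From
  the time \<open>1 / 2\<close> on, that time excluded, the radius is \<open>0\<close>.
\<close>

definition squeeze :: "real \<Rightarrow> int \<Rightarrow> int" where
  "squeeze s z = (if s = 0 then z else max (- (\<lfloor>1 / s\<rfloor> - 1)) (min (\<lfloor>1 / s\<rfloor> - 1) z))"

lemma squeeze_0: "squeeze 0 z = z"
  by (simp add: squeeze_def)

lemma squeeze_late:
  assumes "1 / 2 < s" "s \<le> 1"
  shows "squeeze s z = 0"
proof -
  have "1 \<le> 1 / s" "1 / s < 2"
    using assms by (simp_all add: field_simps)
  then have "\<lfloor>1 / s\<rfloor> = 1"
    by (simp add: floor_eq_iff)
  then show ?thesis
    using assms by (simp add: squeeze_def)
qed

lemma clamp_near: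
  fixes N M a b m :: int
  assumes "\<bar>a - b\<bar> \<le> m" "\<bar>N - M\<bar> \<le> 1" "0 \<le> N" "0 \<le> M" "1 \<le> m"
  shows "\<bar>max (- N) (min N a) - max (- M) (min M b)\<bar> \<le> m"
  using assms by (auto simp: max_def min_def)

text \<open>
  The point where the line from the vertex \<open>e\<^sub>0\<close> through \<open>x\<close> meets the opposite face, reindexed as a
  point of the simplex of one dimension less.  At \<open>x = e\<^sub>0\<close> itself the value is the junk value given
  by division by zero; there \<open>squeeze\<close> is constantly \<open>0\<close>.
\<close>

definition base_point :: "(nat \<Rightarrow> real) \<Rightarrow> nat \<Rightarrow> real" where
  "base_point x = (\<lambda>i. x (Suc i) / (1 - x 0))"

lemma base_point_in_simplex:
  assumes x: "x \<in> standard_simplex (Suc p)" and "x 0 \<noteq> 1"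
  shows "base_point x \<in> standard_simplex p"
proof -
  have lt: "x 0 < 1" and nonneg: "\<And>i. 0 \<le> x i" and zero: "\<And>i. i > Suc p \<Longrightarrow> x i = 0"
    using assms by (auto simp: standard_simplex_def order_less_le)
  have sum: "(\<Sum>i\<le>p. x (Suc i)) = 1 - x 0"
    using x by (simp add: standard_simplex_def sum.atMost_Suc_shift del: sum.atMost_Suc)
  have "x (Suc i) \<le> 1 - x 0" for i
  proof (cases "i \<le> p")
    case True
    then have "x (Suc i) \<le> (\<Sum>i\<le>p. x (Suc i))"
      using nonneg by (intro member_le_sum) auto
    then show ?thesis
      using sum by simp
  next
    case False
    then show ?thesis
      using zero lt by simp
  qed
  then show ?thesis
    using lt nonneg zero sum
    by (auto simp: standard_simplex_def base_point_def simp flip: sum_divide_distrib)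
qed

lemma tendsto_coordinate: "((\<lambda>y::nat \<Rightarrow> real. y i) \<longlongrightarrow> x i) (at x within K)"
proof -
  have "isCont (\<lambda>y::nat \<Rightarrow> real. y i) x"
    using continuous_on_eq_continuous_at[OF open_UNIV, of "\<lambda>y::nat \<Rightarrow> real. y i"]
    by simp
  then show ?thesis
    unfolding isCont_def by (rule tendsto_within_subset) simp
qed

lemma tendsto_base_point:
  assumes "x 0 \<noteq> 1"
  shows "(base_point \<longlongrightarrow> base_point x) (at x within K)"
proof -
  let ?S = "{y::nat \<Rightarrow> real. y 0 \<noteq> 1}"
  have coord: "continuous_on A (\<lambda>y::nat \<Rightarrow> real. y i)" for A i
    by (rule continuous_on_subset[OF continuous_on_product_coordinates]) simp
  have "continuous_on ?S base_point"
    unfolding base_point_def by (intro continuous_intros coord) auto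
  moreover have "open ?S"
    by (intro open_Collect_neq coord continuous_intros)
  ultimately have "isCont base_point x"
    using assms by (simp add: continuous_on_eq_continuous_at)
  then show ?thesis
    unfolding isCont_def by (rule tendsto_within_subset) simp
qed

text \<open>
  The cone with apex \<open>e\<^sub>0\<close>, whose barycentric coordinate serves as the time of the homotopy.
\<close>

definition simplex_cone :: "nat \<Rightarrow> ((nat \<Rightarrow> real) \<Rightarrow> int) \<Rightarrow> (nat \<Rightarrow> real) \<Rightarrow> int" where
  "simplex_cone p \<sigma> =
    restrict (\<lambda>x. squeeze (x 0) (\<sigma> (base_point x))) (standard_simplex (Suc p))"

abbreviation line_simplex :: "nat \<Rightarrow> nat \<Rightarrow> ((nat \<Rightarrow> real) \<Rightarrow> int) \<Rightarrow> bool" where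
  "line_simplex m p \<equiv> closure_singular_simplex p UNIV (line_closure m)"

text \<open>
  Continuity at time \<open>0\<close> holds as the radius exceeds \<open>\<bar>\<sigma> (base_point x)\<bar> + m\<close> shortly after; at times
  strictly between \<open>0\<close> and \<open>1\<close> the radius varies locally by at most one, which
  \<open>clamp_near\<close> tolerates; near the apex the cone is constant.
\<close>

lemma line_simplex_cone:
  assumes m: "1 \<le> m" and \<sigma>: "line_simplex m p \<sigma>"
  shows "line_simplex m (Suc p) (simplex_cone p \<sigma>)"
proof -
  let ?D = "standard_simplex (Suc p)"
  let ?h = "\<lambda>x. squeeze (x 0) (\<sigma> (base_point x))"
  have cont: "rel_continuous_on (standard_simplex p) (line_near m) \<sigma>"
    using \<sigma> by (simp add: line_simplex_iff)
  have inD: "\<forall>\<^sub>F y in at x within ?D. y \<in> ?D" for x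
    by (simp add: eventually_at_filter)
  have base_near: "\<forall>\<^sub>F y in at x within ?D. line_near m (\<sigma> (base_point x)) (\<sigma> (base_point y))"
    if x: "x \<in> ?D" "x 0 < 1" for x
  proof -
    have "base_point x \<in> standard_simplex p"
      using x by (intro base_point_in_simplex) auto
    then obtain S where S: "open S" "base_point x \<in> S"
      "\<And>z. z \<in> S \<Longrightarrow> z \<noteq> base_point x \<Longrightarrow> z \<in> standard_simplex p \<Longrightarrow> line_near m (\<sigma> (base_point x)) (\<sigma> z)"
      using cont unfolding rel_continuous_on_def eventually_at_topological by meson
    have "\<forall>\<^sub>F y in at x within ?D. base_point y \<in> S"
      using x S(1,2) by (intro topological_tendstoD[OF tendsto_base_point]) auto
    moreover have "\<forall>\<^sub>F y in at x within ?D. y 0 < 1"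
      using order_tendstoD(2)[OF tendsto_coordinate] x by blast
    ultimately show ?thesis
      using inD
    proof eventually_elim
      case (elim y)
      then show ?case
        using S(3)[of "base_point y"] base_point_in_simplex[of y p]
        by (cases "base_point y = base_point x") (auto simp: line_near_def)
    qed
  qed
  have "rel_continuous_on ?D (line_near m) ?h"
    unfolding rel_continuous_on_def
  proof
    fix x assume x: "x \<in> ?D"
    then have x01: "0 \<le> x 0" "x 0 \<le> 1"
      by (auto simp: standard_simplex_def)
    consider "x 0 = 0" | "0 < x 0" "x 0 < 1" | "x 0 = 1"
      using x01 by linarith
    then show "\<forall>\<^sub>F y in at x within ?D. line_near m (?h x) (?h y)"
    proof cases
      case 1
      \<comment> \<open>Before time \<open>1 / (\<bar>z\<bar> + m + 2)\<close> the radius is at least \<open>\<bar>z\<bar> + m + 1\<close>, while all nearby values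
        have size at most \<open>\<bar>z\<bar> + m\<close>.\<close>
      define z where "z = \<sigma> (base_point x)"
      have pos: "0 < 1 / real_of_int (\<bar>z\<bar> + int m + 2)"
        by simp
      have "\<forall>\<^sub>F y in at x within ?D. y 0 < 1 / real_of_int (\<bar>z\<bar> + int m + 2)"
        using order_tendstoD(2)[OF tendsto_coordinate[of 0 x]] 1 pos by simp
      moreover have "\<forall>\<^sub>F y in at x within ?D. line_near m z (\<sigma> (base_point y))"
        unfolding z_def using x 1 by (intro base_near) auto
      ultimately show ?thesis
        using inD
      proof eventually_elim
        case (elim y)
        have "squeeze (y 0) (\<sigma> (base_point y)) = \<sigma> (base_point y)"
        proof (cases "y 0 = 0")
          case False
          then have "0 < y 0"
            using elim(3) by (auto simp: standard_simplex_def order_less_le)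
          then have "real_of_int (\<bar>z\<bar> + int m + 2) \<le> 1 / y 0"
            using elim(1) by (simp add: field_simps)
          then have "\<bar>z\<bar> + int m + 2 \<le> \<lfloor>1 / y 0\<rfloor>"
            by (simp only: le_floor_iff)
          then show ?thesis
            using elim(2) False by (auto simp: squeeze_def line_near_def)
        qed (simp add: squeeze_0)
        then show ?case
          using elim(2) 1 by (simp add: squeeze_0 z_def)
      qed
    next
      case 2
      have "((\<lambda>y. 1 / y 0) \<longlongrightarrow> 1 / x 0) (at x within ?D)"
        using 2 by (intro tendsto_intros tendsto_coordinate) auto
      then have "\<forall>\<^sub>F y in at x within ?D. dist (1 / y 0) (1 / x 0) < 1"
        by (rule tendstoD) simp
      moreover have "\<forall>\<^sub>F y in at x within ?D. 0 < y 0"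
        using order_tendstoD(1)[OF tendsto_coordinate[of 0 x]] 2 by simp
      moreover have "\<forall>\<^sub>F y in at x within ?D. line_near m (\<sigma> (base_point x)) (\<sigma> (base_point y))"
        using x 2 by (intro base_near) auto
      ultimately show ?thesis
        using inD
      proof eventually_elim
        case (elim y)
        have floor_pos: "1 \<le> \<lfloor>1 / s\<rfloor>" if "0 < s" "s \<le> 1" for s :: real
          using that by (simp add: le_floor_iff)
        have "y 0 \<le> 1"
          using elim(4) by (simp add: standard_simplex_def)
        moreover have "\<bar>\<lfloor>1 / x 0\<rfloor> - \<lfloor>1 / y 0\<rfloor>\<bar> \<le> 1"
          using elim(1) unfolding dist_real_def by linarith
        ultimately show ?case
          using elim(2,3) 2 m floor_pos[of "x 0"] floor_pos[of "y 0"]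
            clamp_near[of "\<sigma> (base_point x)" "\<sigma> (base_point y)" "int m" "\<lfloor>1 / x 0\<rfloor> - 1" "\<lfloor>1 / y 0\<rfloor> - 1"]
          by (simp add: line_near_def squeeze_def)
      qed
    next
      case 3
      have "\<forall>\<^sub>F y in at x within ?D. 1 / 2 < y 0"
        by (rule order_tendstoD(1)[OF tendsto_coordinate]) (simp add: 3)
      then show ?thesis
        using inD
      proof eventually_elim
        case (elim y)
        then have "y 0 \<le> 1"
          by (simp add: standard_simplex_def)
        then show ?case
          using elim(1) 3 by (simp add: squeeze_late line_near_def)
      qed
    qed
  qed
  moreover have "rel_continuous_on ?D (line_near m) (simplex_cone p \<sigma>) \<longleftrightarrow>
      rel_continuous_on ?D (line_near m) ?h"
    by (rule rel_continuous_on_cong) (simp add: simplex_cone_def)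
  ultimately show ?thesis
    by (simp add: line_simplex_iff simplex_cone_def)
qed

lemma singular_face_cone_0:
  assumes "\<sigma> \<in> extensional (standard_simplex p)"
  shows "singular_face (Suc p) 0 (simplex_cone p \<sigma>) = \<sigma>"
proof
  fix x
  show "singular_face (Suc p) 0 (simplex_cone p \<sigma>) x = \<sigma> x"
  proof (cases "x \<in> standard_simplex p")
    case True
    then have "simplical_face 0 x \<in> standard_simplex (Suc p)"
      by (intro simplical_face_in_standard_simplex) auto
    moreover have "base_point (simplical_face 0 x) = x"
      by (auto simp: base_point_def simplical_face_def)
    moreover have "simplical_face 0 x 0 = 0"
      by (simp add: simplical_face_def)
    ultimately show ?thesis
      using True by (simp add: singular_face_def simplex_cone_def squeeze_0)
  next
    case False
    then show ?thesis
      using assms by (simp add: singular_face_def extensional_def)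
  qed
qed

lemma singular_face_cone_Suc:
  assumes "k \<le> Suc p"
  shows "singular_face (Suc (Suc p)) (Suc k) (simplex_cone (Suc p) \<sigma>)
    = simplex_cone p (singular_face (Suc p) k \<sigma>)"
proof
  fix x
  show "singular_face (Suc (Suc p)) (Suc k) (simplex_cone (Suc p) \<sigma>) x
    = simplex_cone p (singular_face (Suc p) k \<sigma>) x"
  proof (cases "x \<in> standard_simplex (Suc p)")
    case True
    then have face: "simplical_face (Suc k) x \<in> standard_simplex (Suc (Suc p))"
      using assms by (intro simplical_face_in_standard_simplex) auto
    have base: "base_point (simplical_face (Suc k) x) = simplical_face k (base_point x)"
      by (auto simp: base_point_def simplical_face_def fun_eq_iff)
    have apex: "simplical_face (Suc k) x 0 = x 0"
      by (simp add: simplical_face_def)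
    show ?thesis
    proof (cases "x 0 = 1")
      case True
      then show ?thesis
        using \<open>x \<in> _\<close> face apex by (simp add: singular_face_def simplex_cone_def squeeze_late)
    next
      case False
      then show ?thesis
        using \<open>x \<in> _\<close> face apex base base_point_in_simplex[of x p]
        by (simp add: singular_face_def simplex_cone_def)
    qed
  qed (simp add: singular_face_def simplex_cone_def)
qed

lemma singular_face_cone_vertex:
  "singular_face 1 1 (simplex_cone 0 \<sigma>) = restrict (\<lambda>_. 0) (standard_simplex 0)"
proof
  fix x
  show "singular_face 1 1 (simplex_cone 0 \<sigma>) x = restrict (\<lambda>_. 0) (standard_simplex 0) x"
  proof (cases "x \<in> standard_simplex 0")
    case True
    then have "simplical_face 1 x \<in> standard_simplex 1"
      by (intro simplical_face_in_standard_simplex) auto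
    moreover have "simplical_face 1 x 0 = 1"
      using True by (simp add: simplical_face_def standard_simplex_0)
    ultimately show ?thesis
      using True by (simp add: singular_face_def simplex_cone_def squeeze_late)
  qed (simp add: singular_face_def)
qed

text \<open>
  The linear extension of \<open>\<phi>\<close> to the free abelian group, read off from the free abelian group on one
  generator so that linearity is inherited from \<open>frag_extend\<close>.
\<close>

definition frag_weight :: "('a \<Rightarrow> int) \<Rightarrow> ('a \<Rightarrow>\<^sub>0 int) \<Rightarrow> int" where
  "frag_weight \<phi> x = Poly_Mapping.lookup (frag_extend (\<lambda>a. frag_cmul (\<phi> a) (frag_of ())) x) ()"

lemma frag_weight_simps [simp]:
  "frag_weight \<phi> 0 = 0"
  "frag_weight \<phi> (frag_of a) = \<phi> a"
  "frag_weight \<phi> (x + y) = frag_weight \<phi> x + frag_weight \<phi> y"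
  "frag_weight \<phi> (x - y) = frag_weight \<phi> x - frag_weight \<phi> y"
  "frag_weight \<phi> (frag_cmul c x) = c * frag_weight \<phi> x"
  by (simp_all add: frag_weight_def frag_extend_add frag_extend_diff frag_extend_cmul
      lookup_add lookup_minus)

abbreviation augmentation :: "('a \<Rightarrow>\<^sub>0 int) \<Rightarrow> int" where
  "augmentation \<equiv> frag_weight (\<lambda>_. 1)"

lemma keys_frag_extend_of_subset:
  assumes "Poly_Mapping.keys x \<subseteq> S" "\<And>s. s \<in> S \<Longrightarrow> F s \<in> T"
  shows "Poly_Mapping.keys (frag_extend (frag_of \<circ> F) x) \<subseteq> T"
  using keys_frag_extend[of "frag_of \<circ> F" x] assms by (fastforce simp: keys_frag_of)

definition cone_chain :: "nat \<Rightarrow> int chain \<Rightarrow> int chain" where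
  "cone_chain p = frag_extend (frag_of \<circ> simplex_cone p)"

text \<open>
  The face opposite to the apex gives back the simplex, and the other faces are the cones over the
  faces, with shifted index and hence opposite sign.
\<close>

lemma boundary_cone_Suc:
  assumes "Poly_Mapping.keys x \<subseteq> extensional (standard_simplex (Suc p))"
  shows "chain_boundary (Suc (Suc p)) (cone_chain (Suc p) x)
    = x - cone_chain p (chain_boundary (Suc p) x)"
  using assms
proof (induction rule: frag_induction)
  case zero
  show ?case
    by (simp add: cone_chain_def)
next
  case (one \<sigma>)
  have "chain_boundary (Suc (Suc p)) (cone_chain (Suc p) (frag_of \<sigma>))
      = (\<Sum>k\<le>Suc (Suc p). frag_cmul ((-1) ^ k)
          (frag_of (singular_face (Suc (Suc p)) k (simplex_cone (Suc p) \<sigma>))))"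
    by (simp add: cone_chain_def chain_boundary_of del: sum.atMost_Suc)
  also have "\<dots> = frag_of \<sigma>
      - (\<Sum>k\<le>Suc p. frag_cmul ((-1) ^ k) (frag_of (simplex_cone p (singular_face (Suc p) k \<sigma>))))"
    by (subst sum.atMost_Suc_shift)
       (simp add: singular_face_cone_0[OF one] singular_face_cone_Suc sum_negf
         flip: minus_frag_cmul del: sum.atMost_Suc)
  also have "\<dots> = frag_of \<sigma> - cone_chain p (chain_boundary (Suc p) (frag_of \<sigma>))"
    by (simp add: cone_chain_def chain_boundary_of frag_extend_sum frag_extend_cmul comp_def
        del: sum.atMost_Suc)
  finally show ?case .
next
  case (diff a b)
  then show ?case
    by (simp add: cone_chain_def frag_extend_diff chain_boundary_diff)
qed

lemma boundary_cone_0: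
  assumes "Poly_Mapping.keys x \<subseteq> extensional (standard_simplex 0)"
  shows "chain_boundary 1 (cone_chain 0 x)
    = x - frag_cmul (augmentation x) (frag_of (restrict (\<lambda>_. 0) (standard_simplex 0)))"
  using assms
proof (induction rule: frag_induction)
  case zero
  show ?case
    by (simp add: cone_chain_def)
next
  case (one \<sigma>)
  then show ?case
    using singular_face_cone_0[OF one] singular_face_cone_vertex[of \<sigma>]
    by (simp add: cone_chain_def chain_boundary_of restrict_def)
next
  case (diff a b)
  then show ?case
    by (simp add: cone_chain_def frag_extend_diff chain_boundary_diff frag_cmul_diff_distrib)
qed

abbreviation line_chain :: "nat \<Rightarrow> nat \<Rightarrow> int chain \<Rightarrow> bool" where
  "line_chain m p x \<equiv> Poly_Mapping.keys x \<subseteq> Collect (line_simplex m p)"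

lemma line_chain_extensional:
  "line_chain m p x \<Longrightarrow> Poly_Mapping.keys x \<subseteq> extensional (standard_simplex p)"
  by (auto simp: line_simplex_iff)

lemma line_chain_cone:
  assumes "1 \<le> m" "line_chain m p x"
  shows "line_chain m (Suc p) (cone_chain p x)"
  unfolding cone_chain_def using assms
  by (auto intro!: keys_frag_extend_of_subset[OF assms(2)] line_simplex_cone)

lemma line_acyclic:
  assumes "1 \<le> m" "line_chain m (Suc p) x" "chain_boundary (Suc p) x = 0"
  shows "\<exists>y. line_chain m (Suc (Suc p)) y \<and> chain_boundary (Suc (Suc p)) y = x"
  using line_chain_cone[OF assms(1,2)] boundary_cone_Suc[OF line_chain_extensional[OF assms(2)]]
    assms(3)
  by (intro exI[of _ "cone_chain (Suc p) x"]) (simp add: cone_chain_def)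

lemma line_connected:
  assumes "1 \<le> m" "line_chain m 0 x" "augmentation x = 0"
  shows "\<exists>y. line_chain m 1 y \<and> chain_boundary 1 y = x"
  using line_chain_cone[OF assms(1,2)] boundary_cone_0[OF line_chain_extensional[OF assms(2)]]
    assms(3)
  by (intro exI[of _ "cone_chain 0 x"]) simp

section \<open>Chains of the covering\<close>

lemma rel_continuous_on_simplex_map:
  assumes "rel_continuous_on (standard_simplex p) R \<tau>" "\<And>i j. R i j \<Longrightarrow> S (h i) (h j)"
  shows "rel_continuous_on (standard_simplex p) S (simplex_map p h \<tau>)"
proof -
  have "rel_continuous_on (standard_simplex p) S (simplex_map p h \<tau>) \<longleftrightarrow>
      rel_continuous_on (standard_simplex p) S (\<lambda>x. h (\<tau> x))"
    by (rule rel_continuous_on_cong) (simp add: simplex_map_def)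
  then show ?thesis
    using rel_continuous_on_map[of "standard_simplex p" R \<tau> S h] assms by blast
qed

text \<open>
  Naturality of the boundary is purely formal, so it holds for any function, independently of a
  topology on the target.
\<close>

lemma chain_boundary_chain_map_any:
  "chain_boundary (Suc p) (chain_map (Suc p) f x) = chain_map p f (chain_boundary (Suc p) x)"
proof -
  have "Poly_Mapping.keys x \<subseteq> UNIV"
    by simp
  then show ?thesis
  proof (induction rule: frag_induction)
    case (one \<sigma>)
    have "singular_face (Suc p) k (simplex_map (Suc p) f \<sigma>) = simplex_map p f (singular_face (Suc p) k \<sigma>)"
      if "k \<le> Suc p" for k
      using that simplical_face_in_standard_simplex[of "Suc p" k]
      by (auto simp: singular_face_def simplex_map_def)
    then show ?case
      by (simp add: chain_boundary_of chain_map_sum comp_def del: sum.atMost_Suc)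
  qed (simp_all add: chain_boundary_diff chain_map_diff)
qed

abbreviation vertex0 :: "nat \<Rightarrow> real" where
  "vertex0 \<equiv> \<lambda>i. if i = 0 then 1 else 0"

locale wide_cycle =
  fixes m n :: nat
  assumes m_pos: "1 \<le> m" and n_gt: "3 * m < n"
begin

abbreviation circle_simplex :: "nat \<Rightarrow> ((nat \<Rightarrow> real) \<Rightarrow> int) \<Rightarrow> bool" where
  "circle_simplex p \<equiv> closure_singular_simplex p (cyc n) (cyc_closure n m)"

abbreviation circle_chain :: "nat \<Rightarrow> int chain \<Rightarrow> bool" where
  "circle_chain p x \<equiv> Poly_Mapping.keys x \<subseteq> Collect (circle_simplex p)"

abbreviation proj_simplex where
  "proj_simplex p \<equiv> simplex_map p (\<lambda>z. z mod int n)"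

abbreviation proj_chain where
  "proj_chain p \<equiv> chain_map p (\<lambda>z. z mod int n)"

abbreviation shift_chain where
  "shift_chain p \<equiv> chain_map p (\<lambda>z. z + int n)"

lemma line_simplex_shift:
  "line_simplex m p \<tau> \<Longrightarrow> line_simplex m p (simplex_map p (\<lambda>z. z + c) \<tau>)"
  unfolding line_simplex_iff
proof (elim conjE, intro conjI)
  show "simplex_map p (\<lambda>z. z + c) \<tau> \<in> extensional (standard_simplex p)"
    by (simp add: simplex_map_def)
qed (erule rel_continuous_on_simplex_map, simp add: line_near_def)

lemma circle_simplex_proj:
  assumes "line_simplex m p \<tau>"
  shows "circle_simplex p (proj_simplex p \<tau>)"
  unfolding cyc_simplex_iff
proof (intro conjI)
  show "rel_continuous_on (standard_simplex p) (circle_near n m) (proj_simplex p \<tau>)"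
    using assms circle_near_mod by (intro rel_continuous_on_simplex_map[of p "line_near m"])
      (auto simp: line_simplex_iff)
qed (use n_gt in \<open>auto simp: simplex_map_def cyc_def\<close>)

lemma lift_exists:
  assumes "circle_simplex p \<sigma>"
  shows "\<exists>\<tau>. line_simplex m p \<tau> \<and> proj_simplex p \<tau> = \<sigma>"
proof -
  let ?D = "standard_simplex p"
  have \<sigma>: "\<sigma> \<in> extensional ?D" "\<sigma> \<in> ?D \<rightarrow> cyc n" "rel_continuous_on ?D (circle_near n m) \<sigma>"
    using assms by (simp_all add: cyc_simplex_iff)
  obtain g where g: "rel_continuous_on ?D (line_near m) g" "\<And>x. x \<in> ?D \<Longrightarrow> int n dvd g x - \<sigma> x"
    using liftable_standard_simplex[OF n_gt \<sigma>(3)] unfolding liftable_def by blast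
  have "rel_continuous_on ?D (line_near m) (restrict g ?D) \<longleftrightarrow> rel_continuous_on ?D (line_near m) g"
    by (rule rel_continuous_on_cong) simp
  then have "line_simplex m p (restrict g ?D)"
    using g(1) by (simp add: line_simplex_iff)
  moreover have "g x mod int n = \<sigma> x" if "x \<in> ?D" for x
  proof -
    have "g x mod int n = \<sigma> x mod int n"
      using g(2)[OF that] by (simp add: mod_eq_dvd_iff)
    also have "\<dots> = \<sigma> x"
      using \<sigma>(2) that by (auto simp: cyc_def Pi_iff)
    finally show ?thesis .
  qed
  then have "proj_simplex p (restrict g ?D) = \<sigma>"
    using \<sigma>(1) by (auto simp: simplex_map_def extensional_def)
  ultimately show ?thesis
    by blast
qed

lemma lift_unique:
  assumes \<tau>: "line_simplex m p \<tau>" and \<tau>': "line_simplex m p \<tau>'"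
    and eq: "proj_simplex p \<tau> = proj_simplex p \<tau>'"
  shows "\<exists>j. \<tau>' = simplex_map p (\<lambda>z. z + j * int n) \<tau>"
proof -
  let ?D = "standard_simplex p"
  have dvd: "int n dvd \<tau>' x - \<tau> x" if "x \<in> ?D" for x
    using fun_cong[OF eq, of x] that by (simp add: simplex_map_def mod_eq_dvd_iff dvd_diff_commute)
  have v: "vertex0 \<in> ?D"
    by simp
  obtain j where j: "\<tau>' vertex0 - \<tau> vertex0 = int n * j"
    using dvd[OF v] by (auto elim: dvdE)
  have "connected ?D"
    by (rule connected_of_segments) (rule convex_standard_simplex)
  then have "\<tau>' x - \<tau> x = \<tau>' vertex0 - \<tau> vertex0" if "x \<in> ?D" for x
    using \<tau> \<tau>' dvd n_gt v that
    by (intro lift_difference_constant[of m n ?D]) (auto simp: line_simplex_iff)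
  then have "\<tau>' x = \<tau> x + j * int n" if "x \<in> ?D" for x
    using j that by (force simp: algebra_simps)
  moreover have "\<tau>' \<in> extensional ?D"
    using \<tau>' by (simp add: line_simplex_iff)
  ultimately show ?thesis
    by (intro exI[of _ j]) (auto simp: simplex_map_def extensional_def)
qed

definition lift :: "nat \<Rightarrow> ((nat \<Rightarrow> real) \<Rightarrow> int) \<Rightarrow> (nat \<Rightarrow> real) \<Rightarrow> int" where
  "lift p \<sigma> = (SOME \<tau>. line_simplex m p \<tau> \<and> proj_simplex p \<tau> = \<sigma>)"

lemma lift:
  assumes "circle_simplex p \<sigma>"
  shows "line_simplex m p (lift p \<sigma>)" "proj_simplex p (lift p \<sigma>) = \<sigma>"
  using someI_ex[OF lift_exists[OF assms]] unfolding lift_def by blast+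

definition lift_chain :: "nat \<Rightarrow> int chain \<Rightarrow> int chain" where
  "lift_chain p = frag_extend (frag_of \<circ> lift p)"

lemma line_chain_lift: "circle_chain p z \<Longrightarrow> line_chain m p (lift_chain p z)"
  unfolding lift_chain_def by (erule keys_frag_extend_of_subset) (simp add: lift(1))

lemma circle_chain_proj: "line_chain m p x \<Longrightarrow> circle_chain p (proj_chain p x)"
  unfolding chain_map_def by (erule keys_frag_extend_of_subset) (simp add: circle_simplex_proj)

lemma line_chain_shift: "line_chain m p x \<Longrightarrow> line_chain m p (shift_chain p x)"
  unfolding chain_map_def by (erule keys_frag_extend_of_subset) (simp add: line_simplex_shift)

lemma proj_lift_chain: "circle_chain p z \<Longrightarrow> proj_chain p (lift_chain p z) = z"
  by (induction rule: frag_induction)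
     (simp_all add: lift_chain_def lift(2) frag_extend_diff chain_map_diff)

lemma proj_shift_chain: "proj_chain p (shift_chain p x) = proj_chain p x"
proof -
  have "proj_chain p (shift_chain p x) = chain_map p ((\<lambda>z. z mod int n) \<circ> (\<lambda>z. z + int n)) x"
    by (simp add: chain_map_compose)
  then show ?thesis
    by (simp add: comp_def)
qed

lemma line_chain_boundary:
  "line_chain m (Suc p) x \<Longrightarrow> line_chain m p (chain_boundary (Suc p) x)"
  using chain_boundary_closure_chain_group[of x p UNIV "line_closure m"]
  by (simp add: carrier_closure_chain_group)

lemma line_boundary_twice:
  "line_chain m (Suc p) x \<Longrightarrow> chain_boundary p (chain_boundary (Suc p) x) = 0"
  using chain_boundary_twice[of x p UNIV "line_closure m"]
  by (simp add: carrier_closure_chain_group)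

lemma line_chain_add: "line_chain m p x \<Longrightarrow> line_chain m p y \<Longrightarrow> line_chain m p (x + y)"
  using keys_add[of x y] by blast

lemma line_chain_diff: "line_chain m p x \<Longrightarrow> line_chain m p y \<Longrightarrow> line_chain m p (x - y)"
  using keys_diff[of x y] by blast

text \<open>
  A telescoping sum: moving a simplex by \<open>j\<close> periods is a sequence of moves by one period.
\<close>

lemma translate_difference:
  assumes "line_simplex m p \<tau>"
  shows "\<exists>w. line_chain m p w \<and>
    frag_of (simplex_map p (\<lambda>z. z + j * int n) \<tau>) - frag_of \<tau> = shift_chain p w - w"
proof -
  define t where "t j = simplex_map p (\<lambda>z. z + j * int n) \<tau>" for j
  have line: "line_chain m p (frag_of (t j))" for j
    using line_simplex_shift[OF assms] by (simp add: t_def)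
  have step: "shift_chain p (frag_of (t j)) = frag_of (t (j + 1))" for j
    by (auto simp: t_def simplex_map_def fun_eq_iff algebra_simps intro!: arg_cong[of _ _ frag_of])
  have t0: "t 0 = \<tau>"
    using assms by (auto simp: t_def simplex_map_def line_simplex_iff extensional_def)
  have "\<exists>w. line_chain m p w \<and> frag_of (t j) - frag_of \<tau> = shift_chain p w - w"
  proof (induction j rule: int_induct[where k = 0])
    case base
    show ?case
      by (intro exI[of _ 0]) (simp add: t0)
  next
    case (step1 j)
    then obtain w where w: "line_chain m p w" "frag_of (t j) - frag_of \<tau> = shift_chain p w - w"
      by blast
    have "frag_of (t (j + 1)) - frag_of \<tau>
        = (frag_of (t j) - frag_of \<tau>) + (frag_of (t (j + 1)) - frag_of (t j))"
      by simp
    also have "\<dots> = shift_chain p (w + frag_of (t j)) - (w + frag_of (t j))"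
      unfolding w(2) chain_map_add step by simp
    finally show ?case
      using line_chain_add[OF w(1) line] by blast
  next
    case (step2 j)
    then obtain w where w: "line_chain m p w" "frag_of (t j) - frag_of \<tau> = shift_chain p w - w"
      by blast
    have "frag_of (t (j - 1)) - frag_of \<tau>
        = (frag_of (t j) - frag_of \<tau>) - (frag_of (t j) - frag_of (t (j - 1)))"
      by simp
    also have "\<dots> = shift_chain p (w - frag_of (t (j - 1))) - (w - frag_of (t (j - 1)))"
      unfolding w(2) chain_map_diff step by simp
    finally show ?case
      using line_chain_diff[OF w(1) line] by blast
  qed
  then show ?thesis
    by (simp add: t_def)
qed

text \<open>
  Exactness of the sequence \<open>C(\<int>) \<rightarrow> C(\<int>) \<rightarrow> C(\<int>\<^sub>n)\<close> in the middle, where the first map is the shift by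
  \<open>n\<close> minus the identity: chains that project to zero are in its image.  A simplex and the
  chosen lift of its projection differ by a translation.  The chosen lifts need not be compatible
  with faces, since only linearity of \<open>lift_chain\<close> is used.
\<close>

lemma lift_proj_difference:
  assumes "line_chain m p x"
  shows "\<exists>w. line_chain m p w \<and> x - lift_chain p (proj_chain p x) = shift_chain p w - w"
  using assms
proof (induction rule: frag_induction)
  case zero
  show ?case
    by (intro exI[of _ 0]) (simp add: lift_chain_def)
next
  case (one \<tau>)
  let ?\<sigma> = "proj_simplex p \<tau>"
  have \<sigma>: "circle_simplex p ?\<sigma>"
    using one circle_simplex_proj by simp
  obtain j where "\<tau> = simplex_map p (\<lambda>z. z + j * int n) (lift p ?\<sigma>)"
    using lift_unique[of p "lift p ?\<sigma>" \<tau>] lift[OF \<sigma>] one by auto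
  then show ?case
    using translate_difference[OF lift(1)[OF \<sigma>], of j] by (simp add: lift_chain_def)
next
  case (diff a b)
  then obtain u w where
    u: "line_chain m p u" "a - lift_chain p (proj_chain p a) = shift_chain p u - u" and
    w: "line_chain m p w" "b - lift_chain p (proj_chain p b) = shift_chain p w - w"
    by blast
  have "(a - b) - lift_chain p (proj_chain p (a - b))
      = (a - lift_chain p (proj_chain p a)) - (b - lift_chain p (proj_chain p b))"
    by (simp add: lift_chain_def frag_extend_diff chain_map_diff)
  also have "\<dots> = shift_chain p (u - w) - (u - w)"
    unfolding u(2) w(2) chain_map_diff by simp
  finally show ?case
    using line_chain_diff[OF u(1) w(1)] by blast
qed

text \<open>
  Exactness of the same sequence on the left: a finite set of simplices that is invariant under a
  translation is empty, as seen from a simplex whose value at the first vertex is least.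
\<close>

lemma shift_invariant_imp_zero:
  assumes "line_chain m p y" "shift_chain p y = y"
  shows "y = 0"
proof (rule ccontr)
  let ?K = "Poly_Mapping.keys y"
  assume "y \<noteq> 0"
  then have "finite ?K" "?K \<noteq> {}"
    by auto
  then obtain \<tau> where \<tau>: "\<tau> \<in> ?K" "\<And>\<tau>'. \<tau>' \<in> ?K \<Longrightarrow> \<tau> vertex0 \<le> \<tau>' vertex0"
    using ex_min_if_finite[of "(\<lambda>\<tau>. \<tau> vertex0) ` ?K"] by (force simp: not_less)
  have "Poly_Mapping.keys (shift_chain p y) \<subseteq> simplex_map p (\<lambda>z. z + int n) ` ?K"
    unfolding chain_map_def by (rule keys_frag_extend_of_subset[of _ ?K]) auto
  then obtain \<tau>' where "\<tau>' \<in> ?K" "\<tau> = simplex_map p (\<lambda>z. z + int n) \<tau>'"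
    using \<tau>(1) assms(2) by auto
  then show False
    using \<tau>(2)[of \<tau>'] n_gt by (simp add: simplex_map_def)
qed

text \<open>
  The chain \<open>w\<close> represents the image of the class of \<open>z\<close> under the connecting homomorphism of the
  long exact homology sequence of the covering.
\<close>

lemma boundary_lift_cycle:
  assumes z: "circle_chain (Suc p) z" and "chain_boundary (Suc p) z = 0"
  shows "\<exists>w. line_chain m p w \<and>
    chain_boundary (Suc p) (lift_chain (Suc p) z) = shift_chain p w - w"
proof -
  let ?b = "chain_boundary (Suc p) (lift_chain (Suc p) z)"
  have "proj_chain p ?b = 0"
    using assms by (simp add: proj_lift_chain flip: chain_boundary_chain_map_any)
  then show ?thesis
    using lift_proj_difference[OF line_chain_boundary[OF line_chain_lift[OF z]]]
    by (simp add: lift_chain_def)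
qed

text \<open>
  Exactness at the homology of the cycle: if \<open>w\<close> bounds \<open>u\<close>, then the lift of \<open>z\<close> can be
  corrected by a chain that projects to zero so that it becomes a cycle on the line, which bounds.
\<close>

lemma cycle_bounds:
  assumes z: "circle_chain (Suc p) z"
    and w: "chain_boundary (Suc p) (lift_chain (Suc p) z) = shift_chain p w - w"
    and u: "line_chain m (Suc p) u" "chain_boundary (Suc p) u = w"
  shows "\<exists>y. circle_chain (Suc (Suc p)) y \<and> chain_boundary (Suc (Suc p)) y = z"
proof -
  let ?v = "lift_chain (Suc p) z - (shift_chain (Suc p) u - u)"
  have "line_chain m (Suc p) ?v"
    using z u(1) by (intro line_chain_diff line_chain_lift line_chain_shift)
  moreover have "chain_boundary (Suc p) ?v = 0"
    using w u(2) by (simp add: chain_boundary_diff chain_boundary_chain_map_any)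
  ultimately obtain y where y: "line_chain m (Suc (Suc p)) y" "chain_boundary (Suc (Suc p)) y = ?v"
    using line_acyclic[OF m_pos] by blast
  have "chain_boundary (Suc (Suc p)) (proj_chain (Suc (Suc p)) y) = z"
    by (simp add: chain_boundary_chain_map_any y(2) chain_map_diff proj_shift_chain
        proj_lift_chain[OF z])
  then show ?thesis
    using circle_chain_proj[OF y(1)] by blast
qed

theorem cycle_bounds_high_degree:
  assumes z: "circle_chain (Suc (Suc p)) z" "chain_boundary (Suc (Suc p)) z = 0"
  shows "\<exists>y. circle_chain (Suc (Suc (Suc p))) y \<and> chain_boundary (Suc (Suc (Suc p))) y = z"
proof -
  obtain w where w: "line_chain m (Suc p) w"
    "chain_boundary (Suc (Suc p)) (lift_chain (Suc (Suc p)) z) = shift_chain (Suc p) w - w"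
    using boundary_lift_cycle[OF z] by blast
  have "shift_chain p (chain_boundary (Suc p) w) - chain_boundary (Suc p) w
      = chain_boundary (Suc p) (shift_chain (Suc p) w - w)"
    by (simp add: chain_boundary_diff chain_boundary_chain_map_any)
  also have "\<dots> = 0"
    using line_boundary_twice[OF line_chain_lift[OF z(1)]] w(2) by simp
  finally have "chain_boundary (Suc p) w = 0"
    using line_chain_boundary[OF w(1)] by (intro shift_invariant_imp_zero) auto
  then obtain u where "line_chain m (Suc (Suc p)) u" "chain_boundary (Suc (Suc p)) u = w"
    using line_acyclic[OF m_pos w(1)] by blast
  then show ?thesis
    using cycle_bounds[OF z(1) w(2)] by blast
qed

section \<open>Boundaries in degrees zero and one\<close>

lemma augmentation_boundary: "augmentation (chain_boundary 1 x) = 0"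
proof -
  have "Poly_Mapping.keys x \<subseteq> UNIV"
    by simp
  then show ?thesis
    by (induction rule: frag_induction) (simp_all add: chain_boundary_of chain_boundary_diff)
qed

lemma augmentation_lift: "augmentation (lift_chain p z) = augmentation z"
proof -
  have "Poly_Mapping.keys z \<subseteq> UNIV"
    by simp
  then show ?thesis
    by (induction rule: frag_induction) (simp_all add: lift_chain_def frag_extend_diff)
qed

lemma augmentation_zero_imp_boundary:
  assumes z: "circle_chain 0 z" "augmentation z = 0"
  shows "\<exists>y. circle_chain 1 y \<and> chain_boundary 1 y = z"
proof -
  obtain y where y: "line_chain m 1 y" "chain_boundary 1 y = lift_chain 0 z"
    using line_connected[OF m_pos line_chain_lift[OF z(1)]] z(2) by (auto simp: augmentation_lift)
  have "chain_boundary 1 (proj_chain 1 y) = z"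
    using chain_boundary_chain_map_any[of 0 "\<lambda>z. z mod int n" y] y(2) proj_lift_chain[OF z(1)] by simp
  then show ?thesis
    using circle_chain_proj[OF y(1)] by blast
qed

text \<open>
  The total displacement along the lifts of the edges: the faces \<open>0\<close> and \<open>1\<close> of an edge are its end
  and its start.  The value is a multiple of \<open>n\<close> on cycles,
  where it is \<open>n\<close> times the winding number.
\<close>

definition winding :: "int chain \<Rightarrow> int" where
  "winding = frag_weight (\<lambda>\<sigma>. lift 1 \<sigma> (simplical_face 0 vertex0) - lift 1 \<sigma> (simplical_face 1 vertex0))"

abbreviation position_sum :: "int chain \<Rightarrow> int" where
  "position_sum \<equiv> frag_weight (\<lambda>\<tau>. \<tau> vertex0)"

lemma winding_proj:
  assumes "line_chain m 1 x"
  shows "winding (proj_chain 1 x) = position_sum (chain_boundary 1 x)"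
  using assms
proof (induction rule: frag_induction)
  case (one \<tau>)
  let ?\<sigma> = "proj_simplex 1 \<tau>"
  have \<sigma>: "circle_simplex 1 ?\<sigma>"
    using one circle_simplex_proj by simp
  obtain j where j: "\<tau> = simplex_map 1 (\<lambda>z. z + j * int n) (lift 1 ?\<sigma>)"
    using lift_unique[of 1 "lift 1 ?\<sigma>" \<tau>] lift[OF \<sigma>] one by auto
  have ends: "simplical_face k vertex0 \<in> standard_simplex 1" if "k \<le> 1" for k
    using that by (intro simplical_face_in_standard_simplex) auto
  have "\<tau> (simplical_face k vertex0) = lift 1 ?\<sigma> (simplical_face k vertex0) + j * int n" if "k \<le> 1" for k
    using fun_cong[OF j, of "simplical_face k vertex0"] ends[OF that] by (simp add: simplex_map_def)
  then have "\<tau> (simplical_face 0 vertex0) - \<tau> (simplical_face 1 vertex0)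
      = lift 1 ?\<sigma> (simplical_face 0 vertex0) - lift 1 ?\<sigma> (simplical_face 1 vertex0)"
    by simp
  then show ?case
    by (simp add: winding_def chain_boundary_of singular_face_def)
qed (simp_all add: winding_def chain_map_diff chain_boundary_diff)

lemma winding_eq:
  "circle_chain 1 z \<Longrightarrow> winding z = position_sum (chain_boundary 1 (lift_chain 1 z))"
  using winding_proj[OF line_chain_lift] by (simp add: proj_lift_chain)

lemma position_sum_shift:
  "position_sum (shift_chain 0 w) = position_sum w + int n * augmentation w"
proof -
  have "Poly_Mapping.keys w \<subseteq> UNIV"
    by simp
  then show ?thesis
    by (induction rule: frag_induction)
       (simp_all add: chain_map_diff simplex_map_def algebra_simps)
qed

text \<open>
  Displacement by one period adds \<open>n\<close> to each position, so the displacement of \<open>z\<close> is \<open>n\<close> times the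
  augmentation of the chain \<open>w\<close> that the connecting homomorphism assigns to \<open>z\<close>; and \<open>w\<close> bounds as
  soon as its augmentation vanishes, the line being connected.
\<close>

lemma winding_cycle:
  assumes z: "circle_chain 1 z" "chain_boundary 1 z = 0"
  shows "int n dvd winding z"
    and "winding z = 0 \<Longrightarrow> \<exists>y. circle_chain 2 y \<and> chain_boundary 2 y = z"
proof -
  obtain w where w: "line_chain m 0 w" "chain_boundary 1 (lift_chain 1 z) = shift_chain 0 w - w"
    using boundary_lift_cycle[of z 0] z by auto
  then have wind: "winding z = int n * augmentation w"
    by (simp add: winding_eq[OF z(1)] position_sum_shift)
  then show "int n dvd winding z"
    by simp
  assume "winding z = 0"
  then have "augmentation w = 0"
    using wind n_gt by simp
  then obtain u where "line_chain m 1 u" "chain_boundary 1 u = w"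
    using line_connected[OF m_pos w(1)] by blast
  then show "\<exists>y. circle_chain 2 y \<and> chain_boundary 2 y = z"
    using cycle_bounds[of z 0 w u] z(1) w(2) by (simp add: numeral_2_eq_2)
qed

lemma winding_boundary:
  assumes y: "circle_chain 2 y"
  shows "winding (chain_boundary 2 y) = 0"
proof -
  let ?x = "lift_chain 2 y"
  have x: "line_chain m 2 ?x" "proj_chain 2 ?x = y"
    using y line_chain_lift proj_lift_chain by blast+
  have "chain_boundary 2 y = proj_chain 1 (chain_boundary 2 ?x)"
    using chain_boundary_chain_map_any[of 1 "\<lambda>z. z mod int n" ?x] x(2) by (simp add: numeral_2_eq_2)
  then have "winding (chain_boundary 2 y) = position_sum (chain_boundary 1 (chain_boundary 2 ?x))"
    using winding_proj[of "chain_boundary 2 ?x"] line_chain_boundary[of ?x 1] x(1)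
    by (simp add: numeral_2_eq_2)
  then show ?thesis
    using line_boundary_twice[of ?x 1] x(1) by (simp add: numeral_2_eq_2)
qed

text \<open>
  The loop that runs once around the cycle at unit speed, rounded down to integers.
\<close>

lemma winding_generator: "\<exists>z. circle_chain 1 z \<and> chain_boundary 1 z = 0 \<and> winding z = int n"
proof -
  let ?D = "standard_simplex 1"
  define \<gamma> where "\<gamma> = restrict (\<lambda>x. \<lfloor>real n * x 1\<rfloor>) ?D"
  have "rel_continuous_on ?D (line_near m) (\<lambda>x. \<lfloor>real n * x 1\<rfloor>)"
    unfolding rel_continuous_on_def
  proof
    fix x assume "x \<in> ?D"
    have "((\<lambda>y. real n * y 1) \<longlongrightarrow> real n * x 1) (at x within ?D)"
      by (intro tendsto_intros tendsto_coordinate)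
    then have "\<forall>\<^sub>F y in at x within ?D. dist (real n * y 1) (real n * x 1) < 1"
      by (rule tendstoD) simp
    then show "\<forall>\<^sub>F y in at x within ?D. line_near m \<lfloor>real n * x 1\<rfloor> \<lfloor>real n * y 1\<rfloor>"
    proof eventually_elim
      case (elim y)
      then have "\<bar>\<lfloor>real n * x 1\<rfloor> - \<lfloor>real n * y 1\<rfloor>\<bar> \<le> 1"
        unfolding dist_real_def by linarith
      then show ?case
        using m_pos by (simp add: line_near_def)
    qed
  qed
  moreover have "rel_continuous_on ?D (line_near m) \<gamma> \<longleftrightarrow>
      rel_continuous_on ?D (line_near m) (\<lambda>x. \<lfloor>real n * x 1\<rfloor>)"
    by (rule rel_continuous_on_cong) (simp add: \<gamma>_def)
  ultimately have \<gamma>: "line_simplex m 1 \<gamma>"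
    by (simp add: line_simplex_iff \<gamma>_def)
  have ends: "simplical_face k vertex0 \<in> ?D" if "k \<le> 1" for k
    using that by (intro simplical_face_in_standard_simplex) auto
  have "\<gamma> (simplical_face 0 vertex0) = int n" "\<gamma> (simplical_face 1 vertex0) = 0"
    using ends by (simp_all add: \<gamma>_def) (simp_all add: simplical_face_def)
  then have faces: "singular_face 1 0 \<gamma> = restrict (\<lambda>_. int n) (standard_simplex 0)"
    "singular_face 1 1 \<gamma> = restrict (\<lambda>_. 0) (standard_simplex 0)"
    by (intro ext, auto simp: singular_face_def standard_simplex_0 restrict_def)+
  then have bd: "chain_boundary 1 (frag_of \<gamma>) = frag_of (restrict (\<lambda>_. int n) (standard_simplex 0))
      - frag_of (restrict (\<lambda>_. 0) (standard_simplex 0))"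
    by (simp add: chain_boundary_of)
  let ?z = "proj_chain 1 (frag_of \<gamma>)"
  have line: "line_chain m 1 (frag_of \<gamma>)"
    using \<gamma> by simp
  have "chain_boundary 1 ?z = proj_chain 0 (chain_boundary 1 (frag_of \<gamma>))"
    using chain_boundary_chain_map_any[of 0 "\<lambda>z. z mod int n" "frag_of \<gamma>"] by simp
  also have "\<dots> = 0"
    unfolding bd chain_map_diff chain_map_of by (simp add: simplex_map_def comp_def cong: restrict_cong)
  finally have "chain_boundary 1 ?z = 0" .
  moreover have "winding ?z = int n"
    unfolding winding_proj[OF line] bd by simp
  ultimately show ?thesis
    using circle_chain_proj[OF line] by blast
qed

end

section \<open>The homology groups\<close>

text \<open>
  The first isomorphism theorem.  The image is a parameter so that one statement covers the
  infinite cyclic and the trivial homology groups.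
\<close>

lemma homology_iso_image:
  fixes h :: "'a chain \<Rightarrow> int"
  assumes add: "\<And>x y. \<lbrakk>x \<in> closure_cycles p X c; y \<in> closure_cycles p X c\<rbrakk> \<Longrightarrow> h (x + y) = h x + h y"
    and ker: "\<And>x. x \<in> closure_cycles p X c \<Longrightarrow> h x = 0 \<longleftrightarrow> x \<in> closure_boundaries p X c"
    and img: "h ` closure_cycles p X c = S"
  shows "closure_homology_group p X c \<cong> integer_group\<lparr>carrier := S\<rparr>"
proof -
  let ?Z = "(closure_chain_group p X c)\<lparr>carrier := closure_cycles p X c\<rparr>"
  have Z: "group ?Z"
    by (rule comm_group.axioms(2)[OF comm_group_closure_cycles])
  have hom: "h \<in> hom ?Z integer_group"
    using add by (simp add: hom_def integer_group_def closure_chain_group_def free_Abelian_group_def)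
  then interpret H: group_hom ?Z integer_group h
    using Z by (simp add: group_hom_def group_hom_axioms_def)
  have "subgroup S integer_group"
    using H.img_is_subgroup img by simp
  then have "group (integer_group\<lparr>carrier := S\<rparr>)"
    by (intro subgroup.subgroup_is_group) simp_all
  moreover have "h \<in> hom ?Z (integer_group\<lparr>carrier := S\<rparr>)"
    using hom img by (auto simp: hom_def)
  ultimately interpret H': group_hom ?Z "integer_group\<lparr>carrier := S\<rparr>" h
    using Z by (simp add: group_hom_def group_hom_axioms_def)
  have "closure_boundaries p X c \<subseteq> closure_cycles p X c"
    using subgroup.subset[OF closure_boundaries_subgroup[of p X c]] by simp
  then have "kernel ?Z (integer_group\<lparr>carrier := S\<rparr>) h = closure_boundaries p X c"
    using ker by (auto simp: kernel_def integer_group_def)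
  then show ?thesis
    using H'.FactGroup_iso img by (simp add: closure_homology_group_def)
qed

context wide_cycle
begin

lemma cycles_iff:
  "x \<in> closure_cycles p (cyc n) (cyc_closure n m) \<longleftrightarrow> circle_chain p x \<and> chain_boundary p x = 0"
  by (simp add: closure_cycles_iff carrier_closure_chain_group)

lemma boundaries_iff:
  "x \<in> closure_boundaries p (cyc n) (cyc_closure n m) \<longleftrightarrow>
    (\<exists>y. circle_chain (Suc p) y \<and> chain_boundary (Suc p) y = x)"
  unfolding closure_boundaries_def image_iff Bex_def carrier_closure_chain_group by metis

text \<open>
  The invariant is the augmentation in degree \<open>0\<close> and the winding number in degree \<open>1\<close>; above
  that, all cycles bound.
\<close>

theorem circle_homology:
  "closure_homology_group p (cyc n) (cyc_closure n m)
    \<cong> integer_group\<lparr>carrier := if p \<le> 1 then UNIV else {0}\<rparr>"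
proof -
  consider "p = 0" | "p = 1" | q where "p = Suc (Suc q)"
    by (metis One_nat_def not0_implies_Suc)
  then show ?thesis
  proof cases
    case 1
    let ?v = "restrict (\<lambda>_. 0) (standard_simplex 0)"
    have "line_simplex m 0 ?v"
      by (simp add: line_simplex_iff rel_continuous_on_def eventually_at_filter standard_simplex_0)
    then have "circle_simplex 0 (proj_simplex 0 ?v)"
      by (rule circle_simplex_proj)
    then have "a \<in> augmentation ` closure_cycles 0 (cyc n) (cyc_closure n m)" for a
      by (intro image_eqI[of _ _ "frag_cmul a (frag_of (proj_simplex 0 ?v))"])
         (auto simp: cycles_iff chain_boundary_def)
    moreover have "augmentation x = 0 \<longleftrightarrow> x \<in> closure_boundaries 0 (cyc n) (cyc_closure n m)"
      if "x \<in> closure_cycles 0 (cyc n) (cyc_closure n m)" for x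
      using that augmentation_zero_imp_boundary[of x] augmentation_boundary
      by (auto simp: cycles_iff boundaries_iff)
    ultimately show ?thesis
      unfolding 1 by (intro homology_iso_image[where h = augmentation]) auto
  next
    case 2
    let ?h = "\<lambda>z. winding z div int n"
    obtain g where g: "circle_chain 1 g" "chain_boundary 1 g = 0" "winding g = int n"
      using winding_generator by blast
    have n0: "int n \<noteq> 0"
      using n_gt by simp
    have "a \<in> ?h ` closure_cycles 1 (cyc n) (cyc_closure n m)" for a
    proof (rule image_eqI)
      show "frag_cmul a g \<in> closure_cycles 1 (cyc n) (cyc_closure n m)"
        using g keys_cmul[of a g] by (auto simp: cycles_iff chain_boundary_cmul)
      show "a = ?h (frag_cmul a g)"
        using g(3) n0 by (simp add: winding_def)
    qed
    moreover have "?h x = 0 \<longleftrightarrow> x \<in> closure_boundaries 1 (cyc n) (cyc_closure n m)"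
      if "x \<in> closure_cycles 1 (cyc n) (cyc_closure n m)" for x
    proof -
      have x: "circle_chain 1 x" "chain_boundary 1 x = 0"
        using that by (simp_all add: cycles_iff)
      have "?h x = 0 \<longleftrightarrow> winding x = 0"
        using winding_cycle(1)[OF x] n0 by (metis dvd_div_eq_0_iff)
      also have "\<dots> \<longleftrightarrow> (\<exists>y. circle_chain 2 y \<and> chain_boundary 2 y = x)"
        using winding_cycle(2)[OF x] winding_boundary by blast
      finally show ?thesis
        by (simp add: boundaries_iff numeral_2_eq_2)
    qed
    moreover have "?h (x + y) = ?h x + ?h y"
      if "x \<in> closure_cycles 1 (cyc n) (cyc_closure n m)" for x y
      using that winding_cycle(1)[of x] by (simp add: cycles_iff winding_def div_plus_div_distrib_dvd_left)
    ultimately show ?thesis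
      unfolding 2 by (intro homology_iso_image[where h = ?h]) auto
  next
    case 3
    have "x \<in> closure_boundaries p (cyc n) (cyc_closure n m)"
      if "x \<in> closure_cycles p (cyc n) (cyc_closure n m)" for x
      using that cycle_bounds_high_degree[of x q] by (simp add: cycles_iff boundaries_iff 3)
    moreover have "0 \<in> closure_cycles p (cyc n) (cyc_closure n m)"
      by (simp add: cycles_iff)
    ultimately show ?thesis
      using 3 by (intro homology_iso_image[where h = "\<lambda>_. 0"]) auto
  qed
qed

end

theorem theorem5p18:
  fixes m n :: nat and l :: int
  assumes "2 \<le> m"
    and "int n = 3 * int m + l"
    and "max 0 (int m - 3) < l"
    and "l < int m"
  shows "\<forall>k::nat. closure_homology_group k (cyc n) (cyc_closure n m)
           \<cong> closure_homology_group k (cyc (n + 4)) (cyc_closure (n + 4) (m + 1))"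
proof
  fix k
  interpret A: wide_cycle m n
    using assms by unfold_locales auto
  interpret B: wide_cycle "m + 1" "n + 4"
    using assms by unfold_locales auto
  show "closure_homology_group k (cyc n) (cyc_closure n m)
      \<cong> closure_homology_group k (cyc (n + 4)) (cyc_closure (n + 4) (m + 1))"
    using A.circle_homology B.circle_homology group.iso_sym[OF group_closure_homology_group] iso_trans
    by blast
qed

end
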